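(* Let $(V,\sigma)$ be a pre-braided vector space over a field $\Bbbk$ with a braided character $\epsilon$. For all integers $m,k\ge 0$ one has, on $T(V)$, $${}^{\epsilon,(m)}d\circ{}^{\epsilon,(k)}d=\binom{m+k}{k}_{-1}\,{}^{\epsilon,(m+k)}d,\qquad d^{\epsilon,(m)}\circ d^{\epsilon,(k)}=\binom{m+k}{k}_{-1}\,d^{\epsilon,(m+k)},$$ where $\binom{m+k}{k}_{-1}:=0$ if $mk$ is odd, and $\binom{m+k}{k}_{-1}:=\binom{\lfloor (m+k)/2\rfloor}{\lfloor k/2\rfloor}$ otherwise.
   Context: $T(V)=\bigoplus_{n\ge0}V^{\otimes n}$. For a linear map $\varphi:V^{\otimes l}\to V^{\otimes r}$, $\varphi_i=\mathrm{Id}_{V^{\otimes(i-1)}}\otimes\varphi\otimes\mathrm{Id}$. A pre-braiding on $V$ is a linear map $\sigma:V\otimes V\to V\otimes V$ (not necessarily invertible) with $\sigma_1\sigma_2\sigma_1=\sigma_2\sigma_1\sigma_2$ on $V^{\otimes 3}$; then $-\sigma$ is also a pre-braiding. A braided character is $\epsilon\in V^*$ with $(\epsilon\otimes\epsilon)\circ\sigma=\epsilon\otimes\epsilon$. For a pre-braiding $\beta$ and $s\in S_n$ with shortest expression $s=\tau_{i_1}\cdots\tau_{i_k}$ in adjacent transpositions $\tau_i=(i\ i{+}1)$, $T_s^{\beta}=\beta_{i_1}\circ\cdots\circ\beta_{i_k}$ on $V^{\otimes n}$. With $Sh_{p,q}=\{s\in S_{p+q}: s(1)<\dots<s(p),\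 s(p+1)<\dots<s(p+q)\}$, $\mathrm{csh}_{\beta}^{p,q}=\sum_{s\in Sh_{p,q}}T^{\beta}_{s^{-1}}:V^{\otimes(p+q)}\to V^{\otimes p}\otimes V^{\otimes q}$. The hyper-boundaries are the maps $V^{\otimes n}\to V^{\otimes(n-k)}$ (zero if $n<k$) $${}^{\epsilon,(k)}d=(\epsilon^{\otimes k}\otimes\mathrm{Id}_{V^{\otimes(n-k)}})\circ\mathrm{csh}_{-\sigma}^{k,n-k},\qquad d^{\epsilon,(k)}=(-1)^{kn-\frac{k(k+1)}2}(\mathrm{Id}_{V^{\otimes(n-k)}}\otimes\epsilon^{\otimes k})\circ\mathrm{csh}_{-\sigma}^{n-k,k}.$$ *)

theory Defs
  imports Complex_Main "HOL-Library.Function_Algebras" "HOL-Combinatorics.Permutations"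
begin

section \<open>Tensor powers\<close>

definition multilinear ::
  "('k::field \<Rightarrow> 'v::ab_group_add \<Rightarrow> 'v) \<Rightarrow> ('k \<Rightarrow> 'w::ab_group_add \<Rightarrow> 'w) \<Rightarrow> nat \<Rightarrow> ('v list \<Rightarrow> 'w) \<Rightarrow> bool"
where
  "multilinear scale scaleW n f \<longleftrightarrow>
    (\<forall>vs i. length vs = n \<and> i < n \<longrightarrow> Vector_Spaces.linear scale scaleW (\<lambda>u. f (vs[i := u])))"

text \<open>
  The vector space \<open>V\<close> is a type \<open>'v\<close> with a scalar multiplication \<open>scale\<close>.  The pure tensor
  of \<open>v\<^sub>1, \<dots>, v\<^sub>n\<close> is realised as evaluation of \<open>n\<close>-linear forms on \<open>V\<close> at \<open>(v\<^sub>1, \<dots>, v\<^sub>n)\<close>, and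
  the \<open>n\<close>-th tensor power is the linear span of the pure tensors.  Evaluation is set to zero on
  functions that are not \<open>n\<close>-linear, so that equality of tensors is plain equality of functions.
  Over a field this is the tensor power: see \<open>multilinear_tens\<close>, \<open>tensor_power_universal\<close> and
  \<open>tensor_power_linear_eq\<close> below.
\<close>

type_synonym ('v, 'k) tensor = "('v list \<Rightarrow> 'k) \<Rightarrow> 'k"

definition tscale :: "'k::field \<Rightarrow> ('v, 'k) tensor \<Rightarrow> ('v, 'k) tensor" where
  "tscale c x = (\<lambda>f. c * x f)"

definition tens ::
  "('k::field \<Rightarrow> 'v::ab_group_add \<Rightarrow> 'v) \<Rightarrow> 'v list \<Rightarrow> ('v, 'k) tensor" where
  "tens scale vs = (\<lambda>f. if multilinear scale (*) (length vs) f then f vs else 0)"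

definition tensor_power ::
  "('k::field \<Rightarrow> 'v::ab_group_add \<Rightarrow> 'v) \<Rightarrow> nat \<Rightarrow> ('v, 'k) tensor set" where
  "tensor_power scale n = module.span tscale {tens scale vs | vs. length vs = n}"

definition tensor_hom ::
  "('k::field \<Rightarrow> 'v::ab_group_add \<Rightarrow> 'v) \<Rightarrow> nat \<Rightarrow> nat \<Rightarrow> (('v, 'k) tensor \<Rightarrow> ('v, 'k) tensor) \<Rightarrow> bool"
where
  "tensor_hom scale l r \<phi> \<longleftrightarrow>
    (\<forall>x \<in> tensor_power scale l. \<phi> x \<in> tensor_power scale r) \<and>
    (\<forall>x \<in> tensor_power scale l. \<forall>y \<in> tensor_power scale l. \<phi> (x + y) = \<phi> x + \<phi> y) \<and>
    (\<forall>c. \<forall>x \<in> tensor_power scale l. \<phi> (tscale c x) = tscale c (\<phi> x))"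

text \<open>
  If \<open>g\<close> is an \<open>n\<close>-linear tensor-valued map, then \<open>tlift g\<close> is, on the \<open>n\<close>-th tensor power, the
  linear map sending the pure tensor of \<open>vs\<close> to \<open>g vs\<close>.
\<close>

definition tlift :: "('v list \<Rightarrow> ('v, 'k::field) tensor) \<Rightarrow> ('v, 'k) tensor \<Rightarrow> ('v, 'k) tensor" where
  "tlift g x = (\<lambda>f. x (\<lambda>vs. g vs f))"

text \<open>
  \<open>tsandwich scale r us y ws\<close> is \<open>u\<^sub>1 \<otimes> \<dots> \<otimes> u\<^sub>p \<otimes> y \<otimes> w\<^sub>1 \<otimes> \<dots> \<otimes> w\<^sub>q\<close> for \<open>y\<close> in the \<open>r\<close>-th tensor power.
\<close>

definition tsandwich ::
  "('k::field \<Rightarrow> 'v::ab_group_add \<Rightarrow> 'v) \<Rightarrow> nat \<Rightarrow> 'v list \<Rightarrow> ('v, 'k) tensor \<Rightarrow> 'v list \<Rightarrow> ('v, 'k) tensor"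
where
  "tsandwich scale r us y ws =
    (\<lambda>f. if multilinear scale (*) (length us + r + length ws) f
         then y (\<lambda>vs. f (us @ vs @ ws)) else 0)"

text \<open>
  \<open>at_pos scale l r \<phi> i\<close> is the map \<open>\<phi>\<^sub>i = Id \<otimes> \<phi> \<otimes> Id\<close> where \<open>\<phi>\<close> goes from the \<open>l\<close>-th to
  the \<open>r\<close>-th tensor power and the left-hand identity acts on the first \<open>i - 1\<close> factors (so
  \<open>i \<ge> 1\<close>).  It applies to the \<open>n\<close>-th tensor power for every \<open>n \<ge> i - 1 + l\<close>;
  see \<open>at_pos_tens\<close> below.
\<close>

definition at_pos ::
  "('k::field \<Rightarrow> 'v::ab_group_add \<Rightarrow> 'v) \<Rightarrow> nat \<Rightarrow> nat \<Rightarrow> (('v, 'k) tensor \<Rightarrow> ('v, 'k) tensor) \<Rightarrow>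
    nat \<Rightarrow> ('v, 'k) tensor \<Rightarrow> ('v, 'k) tensor"
where
  "at_pos scale l r \<phi> i =
    tlift (\<lambda>vs. tsandwich scale r (take (i - 1) vs)
                  (\<phi> (tens scale (take l (drop (i - 1) vs))))
                  (drop (i - 1 + l) vs))"

text \<open>
  Elements of the direct sum \<open>T(V)\<close> are the families of their homogeneous components.
\<close>

definition tensor_algebra ::
  "('k::field \<Rightarrow> 'v::ab_group_add \<Rightarrow> 'v) \<Rightarrow> (nat \<Rightarrow> ('v, 'k) tensor) set" where
  "tensor_algebra scale = {x. (\<forall>n. x n \<in> tensor_power scale n) \<and> finite {n. x n \<noteq> 0}}"


section \<open>Pre-braidings and braided characters\<close>

definition pre_braiding ::
  "('k::field \<Rightarrow> 'v::ab_group_add \<Rightarrow> 'v) \<Rightarrow> (('v, 'k) tensor \<Rightarrow> ('v, 'k) tensor) \<Rightarrow> bool"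
where
  "pre_braiding scale \<sigma> \<longleftrightarrow>
    tensor_hom scale 2 2 \<sigma> \<and>
    (let \<sigma>\<^sub>1 = at_pos scale 2 2 \<sigma> 1; \<sigma>\<^sub>2 = at_pos scale 2 2 \<sigma> 2 in
      \<forall>x \<in> tensor_power scale 3. \<sigma>\<^sub>1 (\<sigma>\<^sub>2 (\<sigma>\<^sub>1 x)) = \<sigma>\<^sub>2 (\<sigma>\<^sub>1 (\<sigma>\<^sub>2 x)))"

text \<open>
  Since tensors are functionals on multilinear forms, applying the linear form \<open>\<epsilon> \<otimes> \<epsilon>\<close> to \<open>x\<close>
  means evaluating \<open>x\<close> at the bilinear form \<open>(v, w) \<mapsto> \<epsilon> v * \<epsilon> w\<close>.
\<close>

definition braided_character ::
  "('k::field \<Rightarrow> 'v::ab_group_add \<Rightarrow> 'v) \<Rightarrow> (('v, 'k) tensor \<Rightarrow> ('v, 'k) tensor) \<Rightarrow> ('v \<Rightarrow> 'k) \<Rightarrow> bool"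
where
  "braided_character scale \<sigma> \<epsilon> \<longleftrightarrow>
    Vector_Spaces.linear scale (*) \<epsilon> \<and>
    (let \<epsilon>\<epsilon> = (\<lambda>vs. \<Prod>v\<leftarrow>vs. \<epsilon> v) in
      \<forall>x \<in> tensor_power scale 2. \<sigma> x \<epsilon>\<epsilon> = x \<epsilon>\<epsilon>)"


section \<open>Braided coshuffles\<close>

text \<open>The word \<open>[i\<^sub>1, \<dots>, i\<^sub>k]\<close> stands for \<open>\<tau>\<^bsub>i1\<^esub> \<circ> \<dots> \<circ> \<tau>\<^bsub>ik\<^esub>\<close>.\<close>

definition word_perm :: "nat list \<Rightarrow> nat \<Rightarrow> nat" where
  "word_perm is = foldr (\<lambda>i s. transpose i (Suc i) \<circ> s) is id"

definition shortest_expression :: "nat \<Rightarrow> (nat \<Rightarrow> nat) \<Rightarrow> nat list \<Rightarrow> bool" where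
  "shortest_expression n s is \<longleftrightarrow>
    set is \<subseteq> {1..<n} \<and> word_perm is = s \<and>
    (\<forall>js. set js \<subseteq> {1..<n} \<and> word_perm js = s \<longrightarrow> length is \<le> length js)"

text \<open>
  For a pre-braiding \<open>\<beta>\<close> the map \<open>T\<^sub>s\<close> does not depend on the shortest expression that is chosen
  (any two are related by braid relations).
\<close>

definition perm_action ::
  "('k::field \<Rightarrow> 'v::ab_group_add \<Rightarrow> 'v) \<Rightarrow> (('v, 'k) tensor \<Rightarrow> ('v, 'k) tensor) \<Rightarrow>
    nat \<Rightarrow> (nat \<Rightarrow> nat) \<Rightarrow> ('v, 'k) tensor \<Rightarrow> ('v, 'k) tensor"
where
  "perm_action scale \<beta> n s =
    foldr (\<lambda>i g. at_pos scale 2 2 \<beta> i \<circ> g) (SOME is. shortest_expression n s is) id"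

definition shuffles_perm :: "nat \<Rightarrow> nat \<Rightarrow> (nat \<Rightarrow> nat) set" where
  "shuffles_perm p q =
    {s. s permutes {1..p + q} \<and> strict_mono_on {1..p} s \<and> strict_mono_on {p + 1..p + q} s}"

definition csh ::
  "('k::field \<Rightarrow> 'v::ab_group_add \<Rightarrow> 'v) \<Rightarrow> (('v, 'k) tensor \<Rightarrow> ('v, 'k) tensor) \<Rightarrow>
    nat \<Rightarrow> nat \<Rightarrow> ('v, 'k) tensor \<Rightarrow> ('v, 'k) tensor"
where
  "csh scale \<beta> p q x = (\<Sum>s \<in> shuffles_perm p q. perm_action scale \<beta> (p + q) (inv s) x)"


section \<open>Hyper-boundaries\<close>

text \<open>\<open>\<epsilon>\<^sup>k \<otimes> Id\<close>\<close>

definition contract_left ::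
  "('k::field \<Rightarrow> 'v::ab_group_add \<Rightarrow> 'v) \<Rightarrow> ('v \<Rightarrow> 'k) \<Rightarrow> nat \<Rightarrow> ('v, 'k) tensor \<Rightarrow> ('v, 'k) tensor"
where
  "contract_left scale \<epsilon> k =
    tlift (\<lambda>vs. tscale (\<Prod>v\<leftarrow>take k vs. \<epsilon> v) (tens scale (drop k vs)))"

text \<open>\<open>Id \<otimes> \<epsilon>\<^sup>k\<close>, where the identity acts on the first \<open>p\<close> factors and \<open>k\<close> is the number of the
  remaining ones\<close>

definition contract_right ::
  "('k::field \<Rightarrow> 'v::ab_group_add \<Rightarrow> 'v) \<Rightarrow> ('v \<Rightarrow> 'k) \<Rightarrow> nat \<Rightarrow> ('v, 'k) tensor \<Rightarrow> ('v, 'k) tensor"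
where
  "contract_right scale \<epsilon> p =
    tlift (\<lambda>vs. tscale (\<Prod>v\<leftarrow>drop p vs. \<epsilon> v) (tens scale (take p vs)))"

text \<open>
  The component of a hyper-boundary on the \<open>n\<close>-th tensor power.  In the sign, the subtraction and
  the division are exact because \<open>k \<le> n\<close>.
\<close>

definition left_hyper_boundary_on ::
  "('k::field \<Rightarrow> 'v::ab_group_add \<Rightarrow> 'v) \<Rightarrow> (('v, 'k) tensor \<Rightarrow> ('v, 'k) tensor) \<Rightarrow> ('v \<Rightarrow> 'k) \<Rightarrow>
    nat \<Rightarrow> nat \<Rightarrow> ('v, 'k) tensor \<Rightarrow> ('v, 'k) tensor"
where
  "left_hyper_boundary_on scale \<sigma> \<epsilon> k n x =
    (if n < k then 0
     else contract_left scale \<epsilon> k (csh scale (\<lambda>y. - \<sigma> y) k (n - k) x))"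

definition right_hyper_boundary_on ::
  "('k::field \<Rightarrow> 'v::ab_group_add \<Rightarrow> 'v) \<Rightarrow> (('v, 'k) tensor \<Rightarrow> ('v, 'k) tensor) \<Rightarrow> ('v \<Rightarrow> 'k) \<Rightarrow>
    nat \<Rightarrow> nat \<Rightarrow> ('v, 'k) tensor \<Rightarrow> ('v, 'k) tensor"
where
  "right_hyper_boundary_on scale \<sigma> \<epsilon> k n x =
    (if n < k then 0
     else tscale ((- 1) ^ (k * n - k * (k + 1) div 2))
            (contract_right scale \<epsilon> (n - k) (csh scale (\<lambda>y. - \<sigma> y) (n - k) k x)))"

text \<open>
  On \<open>T(V)\<close> the hyper-boundaries lower the degree by \<open>k\<close>: the component of degree \<open>j\<close> of the image
  comes from the component of degree \<open>j + k\<close>, and components of degree less than \<open>k\<close> are killed.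
\<close>

definition left_hyper_boundary ::
  "('k::field \<Rightarrow> 'v::ab_group_add \<Rightarrow> 'v) \<Rightarrow> (('v, 'k) tensor \<Rightarrow> ('v, 'k) tensor) \<Rightarrow> ('v \<Rightarrow> 'k) \<Rightarrow>
    nat \<Rightarrow> (nat \<Rightarrow> ('v, 'k) tensor) \<Rightarrow> (nat \<Rightarrow> ('v, 'k) tensor)"
where
  "left_hyper_boundary scale \<sigma> \<epsilon> k x = (\<lambda>j. left_hyper_boundary_on scale \<sigma> \<epsilon> k (j + k) (x (j + k)))"

definition right_hyper_boundary ::
  "('k::field \<Rightarrow> 'v::ab_group_add \<Rightarrow> 'v) \<Rightarrow> (('v, 'k) tensor \<Rightarrow> ('v, 'k) tensor) \<Rightarrow> ('v \<Rightarrow> 'k) \<Rightarrow>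
    nat \<Rightarrow> (nat \<Rightarrow> ('v, 'k) tensor) \<Rightarrow> (nat \<Rightarrow> ('v, 'k) tensor)"
where
  "right_hyper_boundary scale \<sigma> \<epsilon> k x = (\<lambda>j. right_hyper_boundary_on scale \<sigma> \<epsilon> k (j + k) (x (j + k)))"

definition graded_scale :: "'k::field \<Rightarrow> (nat \<Rightarrow> ('v, 'k) tensor) \<Rightarrow> (nat \<Rightarrow> ('v, 'k) tensor)" where
  "graded_scale c x = (\<lambda>n. tscale c (x n))"

text \<open>The quantum binomial coefficient \<open>m + k\<close> over \<open>k\<close> at \<open>q = -1\<close>.\<close>

definition binomial_minus_one :: "nat \<Rightarrow> nat \<Rightarrow> nat" where
  "binomial_minus_one m k = (if odd (m * k) then 0 else ((m + k) div 2) choose (k div 2))"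


section \<open>The tensor power is the universal target of multilinear maps\<close>

lemma vector_space_tscale: "vector_space (tscale :: 'k::field \<Rightarrow> ('v, 'k) tensor \<Rightarrow> _)"
  by unfold_locales (auto simp: tscale_def fun_eq_iff algebra_simps)

lemma vector_space_mult: "vector_space ((*) :: 'k::field \<Rightarrow> 'k \<Rightarrow> 'k)"
  by unfold_locales (auto simp: algebra_simps)

lemma linear_tensor_apply: "Vector_Spaces.linear tscale (*) (\<lambda>x :: ('v, 'k::field) tensor. x f)"
  unfolding Vector_Spaces.linear_def module_hom_def module_hom_axioms_def
  using vector_space_tscale vector_space_mult
  by (auto simp: module_iff_vector_space tscale_def)

lemma multilinear_compose:
  assumes "multilinear scale scaleW n f" "Vector_Spaces.linear scaleW scaleU g"
  shows "multilinear scale scaleU n (\<lambda>vs. g (f vs))"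
  using assms Vector_Spaces.linear_compose[of scale scaleW _ scaleU g]
  unfolding multilinear_def comp_def by blast

lemma linear_iff:
  fixes scale :: "'k::field \<Rightarrow> 'v::ab_group_add \<Rightarrow> 'v"
  assumes "vector_space scale" "vector_space scaleW"
  shows "Vector_Spaces.linear scale scaleW h \<longleftrightarrow>
    (\<forall>a b. h (a + b) = h a + h b) \<and> (\<forall>c a. h (scale c a) = scaleW c (h a))"
  using assms unfolding Vector_Spaces.linear_def module_hom_def module_hom_axioms_def
  by (auto simp: module_iff_vector_space)

lemma linear_tensor_iff:
  fixes scale :: "'k::field \<Rightarrow> 'v::ab_group_add \<Rightarrow> 'v" and h :: "'v \<Rightarrow> ('w, 'k) tensor"
  assumes "vector_space scale"
  shows "Vector_Spaces.linear scale tscale h \<longleftrightarrow> (\<forall>f. Vector_Spaces.linear scale (*) (\<lambda>u. h u f))"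
  using assms by (auto simp: linear_iff vector_space_tscale vector_space_mult fun_eq_iff tscale_def)

lemma multilinear_tens:
  fixes scale :: "'k::field \<Rightarrow> 'v::ab_group_add \<Rightarrow> 'v"
  assumes "vector_space scale"
  shows "multilinear scale tscale n (tens scale)"
  unfolding multilinear_def
proof (intro allI impI)
  fix vs :: "'v list" and i assume vs: "length vs = n \<and> i < n"
  show "Vector_Spaces.linear scale tscale (\<lambda>u. tens scale (vs[i := u]))"
    unfolding linear_tensor_iff[OF assms]
  proof
    fix f
    show "Vector_Spaces.linear scale (*) (\<lambda>u. tens scale (vs[i := u]) f)"
      using vs assms
      by (cases "multilinear scale (*) n f")
         (auto simp: tens_def multilinear_def linear_iff vector_space_mult)
  qed
qed

lemma tensor_power_linear_eq:
  fixes scale :: "'k::field \<Rightarrow> 'v::ab_group_add \<Rightarrow> 'v"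
    and scaleW :: "'k \<Rightarrow> 'w::ab_group_add \<Rightarrow> 'w"
  assumes "Vector_Spaces.linear tscale scaleW \<phi>" "Vector_Spaces.linear tscale scaleW \<psi>"
    and "\<And>vs. length vs = n \<Longrightarrow> \<phi> (tens scale vs) = \<psi> (tens scale vs)"
    and "x \<in> tensor_power scale n"
  shows "\<phi> x = \<psi> x"
proof -
  interpret TW: vector_space_pair "tscale :: 'k \<Rightarrow> ('v, 'k) tensor \<Rightarrow> _" scaleW
    using assms(1) by (simp add: vector_space_pair_def Vector_Spaces.linear_def)
  show ?thesis
    by (rule TW.linear_eq_on[OF assms(1,2) assms(4)[unfolded tensor_power_def]]) (use assms(3) in auto)
qed

theorem tensor_power_universal:
  fixes scale :: "'k::field \<Rightarrow> 'v::ab_group_add \<Rightarrow> 'v"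
    and scaleW :: "'k \<Rightarrow> 'w::ab_group_add \<Rightarrow> 'w"
  assumes V: "vector_space scale" and W: "vector_space scaleW"
    and f: "multilinear scale scaleW n f"
  shows "\<exists>\<phi>. Vector_Spaces.linear tscale scaleW \<phi> \<and>
             (\<forall>vs. length vs = n \<longrightarrow> \<phi> (tens scale vs) = f vs)"
proof -
  interpret T: vector_space "tscale :: 'k \<Rightarrow> ('v, 'k) tensor \<Rightarrow> _" by (rule vector_space_tscale)
  interpret W: vector_space scaleW by (rule W)
  interpret K: vector_space "(*) :: 'k \<Rightarrow> 'k \<Rightarrow> 'k" by (rule vector_space_mult)
  interpret TW: vector_space_pair "tscale :: 'k \<Rightarrow> ('v, 'k) tensor \<Rightarrow> _" scaleW ..
  interpret WK: vector_space_pair scaleW "(*) :: 'k \<Rightarrow> 'k \<Rightarrow> 'k" ..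
  interpret TK: vector_space_pair "tscale :: 'k \<Rightarrow> ('v, 'k) tensor \<Rightarrow> _" "(*) :: 'k \<Rightarrow> 'k \<Rightarrow> 'k" ..
  let ?P = "{tens scale vs | vs. length vs = n}"
  obtain B where B: "B \<subseteq> ?P" "T.independent B" "?P \<subseteq> T.span B"
    by (rule T.maximal_independent_subset[of ?P])
  define pre where "pre b = (SOME vs. b = tens scale vs \<and> length vs = n)" for b
  have pre: "b = tens scale (pre b) \<and> length (pre b) = n" if "b \<in> B" for b
  proof -
    have "\<exists>vs. b = tens scale vs \<and> length vs = n" using B(1) that by auto
    then show ?thesis unfolding pre_def by (rule someI_ex)
  qed
  have "\<exists>\<phi>. Vector_Spaces.linear tscale scaleW \<phi> \<and> (\<forall>b \<in> B. \<phi> b = f (pre b))"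
    by (rule TW.linear_independent_extend[OF B(2)])
  then obtain \<phi> where \<phi>: "Vector_Spaces.linear tscale scaleW \<phi>" "\<forall>b \<in> B. \<phi> b = f (pre b)"
    by (elim exE conjE)
  have "\<phi> (tens scale vs) = f vs" if vs: "length vs = n" for vs
  proof (rule ccontr)
    assume "\<phi> (tens scale vs) \<noteq> f vs"
    then have "W.independent {\<phi> (tens scale vs) - f vs}"
      by (simp add: W.dependent_single)
    from WK.linear_independent_extend[OF this, of "\<lambda>_. 1"]
    obtain g where g: "Vector_Spaces.linear scaleW (*) g" "g (\<phi> (tens scale vs) - f vs) = 1"
      by (elim exE conjE) simp
    have gf: "multilinear scale (*) n (\<lambda>vs. g (f vs))"
      by (rule multilinear_compose[OF f g(1)])
    have 1: "g (\<phi> b) = b (\<lambda>vs. g (f vs))" if "b \<in> B" for b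
    proof -
      have "length (pre b) = n" by (rule conjunct2[OF pre[OF that]])
      then have "tens scale (pre b) (\<lambda>vs. g (f vs)) = g (f (pre b))"
        using gf by (simp add: tens_def)
      then have "b (\<lambda>vs. g (f vs)) = g (f (pre b))"
        by (simp only: conjunct1[OF pre[OF that], symmetric])
      then show ?thesis using \<phi>(2) that by simp
    qed
    have "tens scale vs \<in> T.span B" using B(3) vs by auto
    then have "g (\<phi> (tens scale vs)) = tens scale vs (\<lambda>vs. g (f vs))"
      using TK.linear_eq_on[OF Vector_Spaces.linear_compose[OF \<phi>(1) g(1)] linear_tensor_apply] 1
      by auto
    also have "\<dots> = g (f vs)" using gf vs by (simp add: tens_def)
    finally show False
      using g WK.linear_diff[OF g(1)] by auto
  qed
  with \<phi>(1) show ?thesis by blast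
qed

lemma tlift_tens:
  fixes scale :: "'k::field \<Rightarrow> 'v::ab_group_add \<Rightarrow> 'v"
  assumes "multilinear scale tscale (length vs) g"
  shows "tlift g (tens scale vs) = g vs"
  using multilinear_compose[OF assms linear_tensor_apply]
  by (auto simp: tlift_def tens_def fun_eq_iff)

lemma multilinear_middle:
  fixes scale :: "'k::field \<Rightarrow> 'v::ab_group_add \<Rightarrow> 'v"
  assumes f: "multilinear scale (*) (length us + r + length ws) f"
  shows "multilinear scale (*) r (\<lambda>vs. f (us @ vs @ ws))"
  unfolding multilinear_def
proof (intro allI impI)
  fix xs :: "'v list" and i assume xs: "length xs = r \<and> i < r"
  have "us @ xs[i := u] @ ws = (us @ xs @ ws)[length us + i := u]" for u
    using xs by (simp add: list_update_append)
  then show "Vector_Spaces.linear scale (*) (\<lambda>u. f (us @ xs[i := u] @ ws))"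
    using f[unfolded multilinear_def, rule_format, of "us @ xs @ ws" "length us + i"] xs by auto
qed

lemma tsandwich_tens:
  "tsandwich scale (length vs) us (tens scale vs) ws = tens scale (us @ vs @ ws)"
  using multilinear_middle[of scale us "length vs" ws]
  by (auto simp: tsandwich_def tens_def fun_eq_iff add.assoc)

lemma linear_tensor_param:
  fixes scale :: "'k::field \<Rightarrow> 'v::ab_group_add \<Rightarrow> 'v"
  assumes V: "vector_space scale" and y: "y \<in> tensor_power scale r"
    and F: "\<And>u. multilinear scale (*) r (F u)"
    and lin: "\<And>ws. length ws = r \<Longrightarrow> Vector_Spaces.linear scale (*) (\<lambda>u. F u ws)"
  shows "Vector_Spaces.linear scale (*) (\<lambda>u. y (F u))"
proof -
  interpret T: vector_space "tscale :: 'k \<Rightarrow> ('v, 'k) tensor \<Rightarrow> _" by (rule vector_space_tscale)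
  show ?thesis using y unfolding tensor_power_def
  proof (induction rule: T.span_induct)
    case base
    show ?case
      using V by (auto simp: T.subspace_def linear_iff vector_space_mult tscale_def algebra_simps)
  next
    case (step y)
    then obtain vs where vs: "y = tens scale vs" "length vs = r" by auto
    then show ?case using F lin[of vs] by (simp add: tens_def)
  qed
qed

lemma at_pos_tens:
  fixes scale :: "'k::field \<Rightarrow> 'v::ab_group_add \<Rightarrow> 'v"
  assumes V: "vector_space scale" and \<phi>: "tensor_hom scale l r \<phi>" and len: "length vs = l"
  shows "at_pos scale l r \<phi> (Suc (length us)) (tens scale (us @ vs @ ws)) =
         tsandwich scale r us (\<phi> (tens scale vs)) ws"
proof -
  define p where "p = length us"
  define n where "n = p + l + length ws"
  define g where "g = (\<lambda>vs. tsandwich scale r (take p vs) (\<phi> (tens scale (take l (drop p vs))))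
                        (drop (p + l) vs))"
  have tens_in: "tens scale xs \<in> tensor_power scale l" if "length xs = l" for xs
  proof -
    interpret T: vector_space "tscale :: 'k \<Rightarrow> ('v, 'k) tensor \<Rightarrow> _" by (rule vector_space_tscale)
    show ?thesis unfolding tensor_power_def by (rule T.span_base) (use that in auto)
  qed
  have "multilinear scale tscale n g"
    unfolding multilinear_def linear_tensor_iff[OF V]
  proof (intro allI impI)
    fix xs :: "'v list" and j f assume xs: "length xs = n \<and> j < n"
    define A B C where "A = take p xs" "B = take l (drop p xs)" "C = drop (p + l) xs"
    have "A @ B = take (p + l) xs" by (simp only: A_B_C_def take_add)
    then have xs_eq: "xs = A @ B @ C" by (simp add: A_B_C_def flip: append_assoc)
    have l: "length A = p" "length B = l" "length C = length ws"
      using xs by (auto simp: A_B_C_def n_def)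
    have g: "g (A' @ B' @ C') f =
        (if multilinear scale (*) (p + r + length ws) f
         then \<phi> (tens scale B') (\<lambda>zs. f (A' @ zs @ C')) else 0)"
      if "length A' = p" "length B' = l" "length C' = length ws" for A' B' C'
      using that by (simp add: g_def tsandwich_def)
    show "Vector_Spaces.linear scale (*) (\<lambda>u. g (xs[j := u]) f)"
    proof (cases "multilinear scale (*) (p + r + length ws) f")
      case False
      have "g (xs[j := u]) f = 0" for u
        using False xs by (auto simp: g_def tsandwich_def n_def)
      then show ?thesis using V by (simp add: linear_iff vector_space_mult)
    next
      case f: True
      have ml: "multilinear scale (*) r (\<lambda>zs. f (A' @ zs @ C'))"
        if "length A' = p" "length C' = length ws" for A' C'
        using multilinear_middle[of scale A' r C' f] f that by simp
      have flin: "Vector_Spaces.linear scale (*) (\<lambda>u. f (ys[h := u]))"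
        if "length ys = p + r + length ws" "h < p + r + length ws" for ys h
        using f that by (auto simp: multilinear_def)
      have in_r: "\<phi> (tens scale B) \<in> tensor_power scale r"
        using \<phi> tens_in l by (auto simp: tensor_hom_def)
      consider "j < p" | "p \<le> j" "j < p + l" | "p + l \<le> j" by linarith
      then show ?thesis
      proof cases
        case 1
        then have "xs[j := u] = A[j := u] @ B @ C" for u
          using l by (simp add: xs_eq list_update_append)
        moreover have "Vector_Spaces.linear scale (*)
            (\<lambda>u. \<phi> (tens scale B) (\<lambda>zs. f (A[j := u] @ zs @ C)))"
        proof (rule linear_tensor_param[OF V in_r])
          show "Vector_Spaces.linear scale (*) (\<lambda>u. f (A[j := u] @ zs @ C))"
            if "length zs = r" for zs
            using flin[of "A @ zs @ C" j] that l 1 by (simp add: list_update_append)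
        qed (use ml l in auto)
        ultimately show ?thesis using g f l by simp
      next
        case 2
        then have jp: "j - p < l" by linarith
        then have upd: "xs[j := u] = A @ B[j - p := u] @ C" for u
          using l 2 by (simp add: xs_eq list_update_append)
        have "Vector_Spaces.linear scale tscale (\<lambda>u. tens scale (B[j - p := u]))"
          using multilinear_tens[OF V, of l] l jp by (auto simp: multilinear_def)
        then have "Vector_Spaces.linear scale tscale (\<lambda>u. \<phi> (tens scale (B[j - p := u])))"
          using \<phi> tens_in l V by (simp add: linear_iff vector_space_tscale tensor_hom_def)
        then have "Vector_Spaces.linear scale (*)
            (\<lambda>u. \<phi> (tens scale (B[j - p := u])) (\<lambda>zs. f (A @ zs @ C)))"
          unfolding linear_tensor_iff[OF V] by (rule spec)
        then show ?thesis using g f l upd by simp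
      next
        case 3
        then obtain h where h: "j = p + l + h" using le_Suc_ex by blast
        have "xs[j := u] = A @ B @ C[h := u]" for u
          using l by (simp add: h xs_eq list_update_append)
        moreover have "Vector_Spaces.linear scale (*)
            (\<lambda>u. \<phi> (tens scale B) (\<lambda>zs. f (A @ zs @ C[h := u])))"
        proof (rule linear_tensor_param[OF V in_r])
          show "Vector_Spaces.linear scale (*) (\<lambda>u. f (A @ zs @ C[h := u]))"
            if "length zs = r" for zs
            using flin[of "A @ zs @ C" "p + r + h"] that l xs h
            by (simp add: list_update_append n_def)
        qed (use ml l in auto)
        ultimately show ?thesis using g f l by simp
      qed
    qed
  qed
  moreover have "length (us @ vs @ ws) = n" using len by (simp add: n_def p_def)
  ultimately have "tlift g (tens scale (us @ vs @ ws)) = g (us @ vs @ ws)"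
    by (metis tlift_tens)
  then show ?thesis using len by (simp add: at_pos_def g_def p_def)
qed

end

theory Submission
  imports Defs
begin

text \<open>
  Write \<open>b\<^sub>i\<close> for \<open>-\<sigma>\<close> acting on the factors \<open>i, i + 1\<close>.  Two facts about the coshuffles
  \<open>csh\<^bsup>p,q\<^esup>\<close> give both identities.  The first is coassociativity on \<open>V\<^sup>\<otimes>\<^sup>(\<^sup>k\<^sup>+\<^sup>m\<^sup>+\<^sup>r\<^sup>)\<close>,
  \<open>(Id \<otimes> csh\<^bsup>m,r\<^esup>) \<circ> csh\<^bsup>k,m+r\<^esup> = (csh\<^bsup>k,m\<^esup> \<otimes> Id) \<circ> csh\<^bsup>k+m,r\<^esup>\<close>
  (\<open>coshuffle_coassoc\<close>).  The second is that \<open>\<epsilon>\<^bsup>k+m\<^esup>\<close> turns every \<open>b\<^sub>i\<close> into the sign \<open>-1\<close>, because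
  \<open>\<epsilon> \<otimes> \<epsilon>\<close> is \<open>\<sigma>\<close>-invariant; hence \<open>\<epsilon>\<^bsup>k+m\<^esup> \<circ> csh\<^bsup>k,m\<^esup>\<close> is \<open>\<epsilon>\<^bsup>k+m\<^esup>\<close> times the signed count of
  shuffles, which is the Gaussian binomial coefficient at \<open>-1\<close> (\<open>contract_left_coshuffle\<close>,
  \<open>contract_right_coshuffle\<close>).  For the left hyper-boundaries, \<open>\<epsilon>\<^sup>k \<otimes> Id\<close> commutes past the second
  coshuffle, which becomes a coshuffle on the last factors; coassociativity then leaves
  \<open>csh\<^bsup>k,m\<^esup>\<close> on exactly the factors that \<open>\<epsilon>\<^bsup>k+m\<^esup>\<close> contracts.  The right-hand case reads
  coassociativity in the other direction, and its signs add up exactly (\<open>sign_exponent_add\<close>).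

  Coassociativity is proved from a Pascal-type recursion, obtained by asking whether the shuffle
  takes its largest value on its first or on its second block:
  \<open>csh\<^bsup>p+1,q+1\<^esup> = csh\<^bsup>p+1,q\<^esup> + b\<^bsub>p+1\<^esub> \<dots> b\<^bsub>p+q+1\<^esub> csh\<^bsup>p,q+1\<^esup>\<close>.  The induction needs only that distant
  operators commute and that \<open>b\<^bsub>j+1\<^esub> (b\<^sub>i \<dots> b\<^sub>l) = (b\<^sub>i \<dots> b\<^sub>l) b\<^sub>j\<close> for \<open>i \<le> j < l\<close>, the
  naturality of the braiding
  (\<open>word_op_shift\<close>).

  The recursion presupposes that \<open>T\<^sub>s\<close> does not depend on the reduced word.  For inverses \<open>s\<^sup>-\<^sup>1\<close> of
  shuffles this does not require Matsumoto's theorem.  Such an \<open>s\<close> is determined by the set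
  \<open>A = s{1, \<dots>, p}\<close>, and the reduced words of \<open>s\<^sup>-\<^sup>1\<close> are precisely the ways to move \<open>A\<close> down to
  \<open>{1, \<dots>, p}\<close> by steps that replace an element \<open>i + 1\<close> by \<open>i\<close>.  Two different steps that are both
  possible at \<open>A\<close> are always distant, so that a diamond argument with commutation alone suffices
  (\<open>shortest_expression_shuffle\<close>, \<open>word_op_lowering_unique\<close>).
\<close>

section \<open>Reduced words of inverse shuffles\<close>

text \<open>
  The steps are listed with the first one at the end of the word, because in
  \<open>b\<^bsub>i1\<^esub> \<circ> \<dots> \<circ> b\<^bsub>ik\<^esub>\<close> the last letter acts first.
\<close>
inductive lowering :: "nat \<Rightarrow> nat set \<Rightarrow> nat list \<Rightarrow> bool" for p where
  lowering_base: "lowering p {1..p} []"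
| lowering_step: "lowering p A (w @ [i])"
    if "1 \<le> i" "i \<notin> A" "Suc i \<in> A" "lowering p (insert i (A - {Suc i})) w"

lemma lowering_finite_pos: "lowering p A w \<Longrightarrow> finite A \<and> 0 \<notin> A"
  by (induction rule: lowering.induct) auto

lemma sum_lower:
  assumes "finite A" "i \<notin> A" "Suc i \<in> A"
  shows "\<Sum>A = Suc (\<Sum>(insert i (A - {Suc i})))"
  using assms by (simp add: sum.remove[of A "Suc i"])

lemma card_lower:
  assumes "finite A" "i \<notin> A" "Suc i \<in> A"
  shows "card (insert i (A - {Suc i})) = card A"
  using assms card_Suc_Diff1[of A "Suc i"] by simp

text \<open>Each step lowers the sum of the set by one, so all lowerings of a set have the same length.\<close>
lemma lowering_sum: "lowering p A w \<Longrightarrow> \<Sum>A = \<Sum>{1..p} + length w"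
proof (induction rule: lowering.induct)
  case (lowering_step i A w)
  then have "finite A" using lowering_finite_pos by fastforce
  with lowering_step show ?case by (simp add: sum_lower)
qed simp

lemma lowering_card: "lowering p A w \<Longrightarrow> card A = p"
proof (induction rule: lowering.induct)
  case (lowering_step i A w)
  then have "finite A" using lowering_finite_pos by fastforce
  with lowering_step show ?case using card_lower by metis
qed simp

text \<open>
  First bring \<open>A\<close> down to \<open>{1..p}\<close>, leaving the new maximum in place; then bring the maximum down
  from \<open>n + 1\<close> to \<open>p + 1\<close>.  The prefix of the word is the factor in the recursion for coshuffles.
\<close>
lemma lowering_insert_max:
  assumes "lowering p A w" "A \<subseteq> {1..n}"
  shows "lowering (Suc p) (insert (Suc n) A) ([Suc p..<Suc n] @ w)"
  using assms
proof (induction rule: lowering.induct)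
  case lowering_base
  have "lowering (Suc p) (insert (Suc n) {1..p}) [Suc p..<Suc n]" if "p \<le> n"
    using that
  proof (induction n rule: dec_induct)
    case base
    have "insert (Suc p) {1..p} = {1..Suc p}" by auto
    then show ?case using lowering.lowering_base[of "Suc p"] by simp
  next
    case (step n)
    have "insert (Suc n) (insert (Suc (Suc n)) {1..p} - {Suc (Suc n)}) = insert (Suc n) {1..p}"
      using step.hyps by auto
    then have "lowering (Suc p) (insert (Suc (Suc n)) {1..p}) ([Suc p..<Suc n] @ [Suc n])"
      using step by (intro lowering_step) auto
    then show ?case using step.hyps by simp
  qed
  moreover have "p \<le> n" using lowering_base by (cases p) auto
  ultimately show ?case by simp
next
  case (lowering_step i A w)
  have "insert i (A - {Suc i}) \<subseteq> {1..n}" using lowering_step.hyps lowering_step.prems by auto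
  moreover have "insert (Suc n) (insert i (A - {Suc i})) = insert i (insert (Suc n) A - {Suc i})"
    using lowering_step.hyps lowering_step.prems by auto
  ultimately have "lowering (Suc p) (insert i (insert (Suc n) A - {Suc i})) ([Suc p..<Suc n] @ w)"
    using lowering_step.IH by simp
  moreover have "i \<noteq> Suc n" using lowering_step.hyps lowering_step.prems by auto
  ultimately have "lowering (Suc p) (insert (Suc n) A) (([Suc p..<Suc n] @ w) @ [i])"
    using lowering_step.hyps by (intro lowering.lowering_step) auto
  then show ?case by simp
qed

lemma lowering_exists:
  assumes "A \<subseteq> {1..n}"
  shows "\<exists>w. lowering (card A) A w"
  using assms
proof (induction n arbitrary: A)
  case 0
  then show ?case using lowering_base[of 0] by auto
next
  case (Suc n)
  show ?case
  proof (cases "Suc n \<in> A")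
    case True
    have sub: "A - {Suc n} \<subseteq> {1..n}" using Suc.prems by (auto simp: le_Suc_eq)
    have "finite A" using Suc.prems finite_subset by blast
    then have "card A = Suc (card (A - {Suc n}))" using True by (metis card_Suc_Diff1)
    moreover obtain w where "lowering (card (A - {Suc n})) (A - {Suc n}) w"
      using Suc.IH[OF sub] by blast
    ultimately show ?thesis
      using lowering_insert_max[OF _ sub] True by (metis insert_Diff)
  next
    case False
    then have "A \<subseteq> {1..n}" using Suc.prems by (auto simp: le_Suc_eq)
    then show ?thesis by (rule Suc.IH)
  qed
qed

lemma word_perm_append: "word_perm (v @ w) = word_perm v \<circ> word_perm w"
  unfolding word_perm_def by (induction v) (auto simp: comp_assoc)

lemma word_perm_snoc: "word_perm (w @ [i]) = word_perm w \<circ> transpose i (Suc i)"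
  by (simp add: word_perm_append) (simp add: word_perm_def)

lemma bij_word_perm: "bij (word_perm w)"
proof (induction w rule: rev_induct)
  case Nil
  show ?case by (simp add: word_perm_def bij_id[unfolded id_def] id_def)
next
  case (snoc i w)
  then show ?case unfolding word_perm_snoc by (intro bij_comp bij_transpose)
qed

lemma inv_word_perm_snoc: "inv (word_perm (w @ [i])) = transpose i (Suc i) \<circ> inv (word_perm w)"
  by (simp add: word_perm_snoc o_inv_distrib bij_word_perm)

lemma transpose_image_cases:
  fixes A :: "nat set"
  shows "transpose i (Suc i) ` A =
    (if i \<in> A \<and> Suc i \<notin> A then insert (Suc i) (A - {i})
     else if Suc i \<in> A \<and> i \<notin> A then insert i (A - {Suc i}) else A)"
proof (rule set_eqI)
  fix x
  have "x \<in> transpose i (Suc i) ` A \<longleftrightarrow> transpose i (Suc i) x \<in> A"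
    by (metis image_iff transpose_involutory)
  then show "x \<in> transpose i (Suc i) ` A \<longleftrightarrow> x \<in> (if i \<in> A \<and> Suc i \<notin> A then insert (Suc i) (A - {i})
     else if Suc i \<in> A \<and> i \<notin> A then insert i (A - {Suc i}) else A)"
    by (cases "x = i"; cases "x = Suc i") (simp_all, blast+)
qed

text \<open>
  An adjacent transposition raises the sum of a set by at most one, and by exactly one only when
  it undoes a lowering step.  The sum therefore bounds the length of a word from below, and the
  words that attain the bound are lowerings.
\<close>
lemma word_image_sum:
  fixes p :: nat
  assumes "set w \<subseteq> {1..}"
  defines "A \<equiv> inv (word_perm w) ` {1..p}"
  shows "\<Sum>A \<le> \<Sum>{1..p} + length w"
    and "\<Sum>A = \<Sum>{1..p} + length w \<Longrightarrow> lowering p A w"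
proof -
  have *: "finite A \<and> \<Sum>A \<le> \<Sum>{1..p} + length w \<and> (\<Sum>A = \<Sum>{1..p} + length w \<longrightarrow> lowering p A w)"
    using assms(1) unfolding A_def
  proof (induction w rule: rev_induct)
    case Nil
    then show ?case using lowering_base[of p] by (simp add: word_perm_def inv_id)
  next
    case (snoc i w)
    define B where "B = inv (word_perm w) ` {1..p}"
    have IH: "finite B" "\<Sum>B \<le> \<Sum>{1..p} + length w"
      "\<Sum>B = \<Sum>{1..p} + length w \<Longrightarrow> lowering p B w"
      using snoc unfolding B_def by auto
    have A: "inv (word_perm (w @ [i])) ` {1..p} = transpose i (Suc i) ` B"
      by (simp add: inv_word_perm_snoc B_def image_comp)
    consider "i \<in> B" "Suc i \<notin> B" | "Suc i \<in> B" "i \<notin> B" | "i \<in> B \<longleftrightarrow> Suc i \<in> B" by blast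
    then show ?case
    proof cases
      case 1
      define A where "A = insert (Suc i) (B - {i})"
      have 2: "insert i (A - {Suc i}) = B" "i \<notin> A" "Suc i \<in> A" "finite A"
        using 1 IH(1) by (auto simp: A_def)
      have "\<Sum>A = Suc (\<Sum>B)" using sum_lower[of A i] 2 by simp
      moreover have "lowering p A (w @ [i])" if "lowering p B w"
        using that 2 snoc.prems by (intro lowering_step) auto
      moreover have "inv (word_perm (w @ [i])) ` {1..p} = A"
        using A 1 by (simp add: transpose_image_cases A_def)
      ultimately show ?thesis using 2(4) IH by simp
    next
      case 2
      have "\<Sum>B = Suc (\<Sum>(insert i (B - {Suc i})))" using sum_lower[OF IH(1)] 2 by blast
      moreover have "inv (word_perm (w @ [i])) ` {1..p} = insert i (B - {Suc i})"
        using A 2 by (simp add: transpose_image_cases)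
      ultimately show ?thesis using IH(1,2) by (simp del: sum.insert)
    next
      case 3
      then have "inv (word_perm (w @ [i])) ` {1..p} = B"
        using A by (simp add: transpose_image_cases)
      then show ?thesis using IH(1,2) by simp
    qed
  qed
  show "\<Sum>A \<le> \<Sum>{1..p} + length w"
    by (rule conjunct1[OF conjunct2[OF *]])
  show "lowering p A w" if "\<Sum>A = \<Sum>{1..p} + length w"
    by (rule mp[OF conjunct2[OF conjunct2[OF *]] that])
qed

lemma strict_mono_on_transpose:
  fixes s :: "nat \<Rightarrow> nat"
  assumes s: "strict_mono_on I s" and not_both: "\<not> (i \<in> s ` I \<and> Suc i \<in> s ` I)"
  shows "strict_mono_on I (transpose i (Suc i) \<circ> s)"
proof (rule strict_mono_onI)
  fix x y assume xy: "x \<in> I" "y \<in> I" "x < y"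
  then have "s x < s y" using s by (simp add: strict_mono_on_def)
  moreover have "\<not> (s x = i \<and> s y = Suc i)" using not_both xy by (metis image_eqI)
  ultimately show "(transpose i (Suc i) \<circ> s) x < (transpose i (Suc i) \<circ> s) y"
    by (auto simp: transpose_def)
qed

text \<open>
  A lowering step exchanges the values \<open>i\<close> and \<open>i + 1\<close>, which lie in different blocks of the
  shuffle, so both blocks stay increasing.
\<close>
lemma lowering_shuffle:
  assumes "lowering p A w" "A \<subseteq> {1..p + q}"
  shows "inv (word_perm w) \<in> shuffles_perm p q \<and> inv (word_perm w) ` {1..p} = A \<and> set w \<subseteq> {1..<p + q}"
  using assms
proof (induction rule: lowering.induct)
  case lowering_base
  have "inv (word_perm []) = id" by (simp add: word_perm_def inv_id[unfolded id_def] id_def)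
  then show ?case using permutes_id by (auto simp: shuffles_perm_def strict_mono_on_def id_def)
next
  case (lowering_step i A w)
  define A' where "A' = insert i (A - {Suc i})"
  define s where "s = inv (word_perm w)"
  have i: "1 \<le> i" "Suc i \<le> p + q" using lowering_step by auto
  have IH: "s permutes {1..p + q}" "strict_mono_on {1..p} s" "strict_mono_on {p + 1..p + q} s"
    "s ` {1..p} = A'" "set w \<subseteq> {1..<p + q}"
    using lowering_step.IH lowering_step.prems i unfolding A'_def s_def shuffles_perm_def by auto
  have "s ` {p + 1..p + q} \<inter> A' = {}"
    unfolding IH(4)[symmetric]
    by (subst image_Int[OF permutes_inj[OF IH(1)], symmetric]) auto
  then have m: "strict_mono_on {p + 1..p + q} (transpose i (Suc i) \<circ> s)"
    using IH(3) by (intro strict_mono_on_transpose) (auto simp: A'_def)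
  have m': "strict_mono_on {1..p} (transpose i (Suc i) \<circ> s)"
    using IH(2,4) by (intro strict_mono_on_transpose) (auto simp: A'_def)
  have "transpose i (Suc i) permutes {1..p + q}" using i by (intro permutes_swap_id) auto
  then have "transpose i (Suc i) \<circ> s permutes {1..p + q}" by (rule permutes_compose[OF IH(1)])
  moreover have "(transpose i (Suc i) \<circ> s) ` {1..p} = A"
    unfolding image_comp[symmetric] IH(4) transpose_image_cases
    using lowering_step.hyps by (auto simp: A'_def)
  moreover have "set (w @ [i]) \<subseteq> {1..<p + q}" using IH(5) i by auto
  ultimately show ?case
    using m m' unfolding inv_word_perm_snoc shuffles_perm_def s_def[symmetric] by blast
qed

lemma strict_mono_on_eq:
  fixes s t :: "nat \<Rightarrow> nat"
  assumes "strict_mono_on {a..b} s" "strict_mono_on {a..b} t" "s ` {a..b} = t ` {a..b}"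
    and "x \<in> {a..b}"
  shows "s x = t x"
proof -
  have sd: "sorted (map f [a..<Suc b]) \<and> distinct (map f [a..<Suc b])"
    if "strict_mono_on {a..b} f" for f :: "nat \<Rightarrow> nat"
  proof -
    have "sorted_wrt (<) (map f [a..<Suc b])"
      unfolding sorted_wrt_map
      by (rule sorted_wrt_mono_rel[OF _ sorted_wrt_upt])
         (use that in \<open>auto simp: strict_mono_on_def simp del: upt_Suc\<close>)
    then show ?thesis unfolding strict_sorted_iff .
  qed
  have "set [a..<Suc b] = {a..b}" by auto
  then have "map s [a..<Suc b] = map t [a..<Suc b]"
    using sd[OF assms(1)] sd[OF assms(2)] assms(3)
    by (intro sorted_distinct_set_unique) (simp_all del: upt_Suc)
  then show ?thesis using assms(4) by (auto simp: map_eq_conv simp del: upt_Suc)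
qed

text \<open>An increasing enumeration of a finite set of naturals is unique, on either block.\<close>
lemma shuffle_eq:
  assumes s: "s \<in> shuffles_perm p q" and t: "t \<in> shuffles_perm p q" and eq: "s ` {1..p} = t ` {1..p}"
  shows "s = t"
proof
  fix x
  have perm: "s permutes {1..p + q}" "t permutes {1..p + q}"
    using s t by (auto simp: shuffles_perm_def)
  have compl: "u ` {p + 1..p + q} = {1..p + q} - u ` {1..p}" if "u permutes {1..p + q}" for u
  proof -
    have "{p + 1..p + q} = {1..p + q} - {1..p}" by auto
    then show ?thesis
      using image_set_diff[OF permutes_inj[OF that]] permutes_image[OF that] by metis
  qed
  show "s x = t x"
  proof (cases "x \<in> {1..p + q}")
    case True
    then consider "x \<in> {1..p}" | "x \<in> {p + 1..p + q}" by fastforce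
    then show ?thesis
    proof cases
      case 1
      show ?thesis by (rule strict_mono_on_eq[OF _ _ eq 1]) (use s t in \<open>auto simp: shuffles_perm_def\<close>)
    next
      case 2
      show ?thesis
        by (rule strict_mono_on_eq[OF _ _ _ 2]) (use s t compl[OF perm(1)] compl[OF perm(2)] eq in \<open>auto simp: shuffles_perm_def\<close>)
    qed
  next
    case False
    then show ?thesis using perm by (simp add: permutes_def)
  qed
qed

lemma shuffle_image:
  assumes "s \<in> shuffles_perm p q"
  shows "s ` {1..p} \<subseteq> {1..p + q} \<and> card (s ` {1..p}) = p"
proof -
  have s: "s permutes {1..p + q}" using assms by (simp add: shuffles_perm_def)
  have "s ` {1..p} \<subseteq> s ` {1..p + q}" by (rule image_mono) auto
  then show ?thesis
    using permutes_image[OF s] card_image[OF inj_on_subset[OF permutes_inj[OF s]], of "{1..p}"] by auto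
qed

lemma bij_betw_shuffles_subsets:
  "bij_betw (\<lambda>s. s ` {1..p}) (shuffles_perm p q) {A. A \<subseteq> {1..p + q} \<and> card A = p}"
proof (rule bij_betw_imageI)
  show "inj_on (\<lambda>s. s ` {1..p}) (shuffles_perm p q)" by (rule inj_onI) (rule shuffle_eq)
  show "(\<lambda>s. s ` {1..p}) ` shuffles_perm p q = {A. A \<subseteq> {1..p + q} \<and> card A = p}" (is "?L = ?R")
  proof
    show "?L \<subseteq> ?R" using shuffle_image by blast
    show "?R \<subseteq> ?L"
    proof
      fix A assume "A \<in> ?R"
      then have A: "A \<subseteq> {1..p + q}" "card A = p" by auto
      from lowering_exists[OF A(1)] A(2) obtain w where "lowering p A w" by auto
      from lowering_shuffle[OF this A(1)] show "A \<in> ?L" by force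
    qed
  qed
qed

text \<open>
  Some lowering of \<open>s{1..p}\<close> represents \<open>s\<^sup>-\<^sup>1\<close>, and by \<open>word_image_sum\<close> its length is minimal.
  Every shortest expression attains the same minimum, hence is itself a lowering.
\<close>
lemma shortest_expression_shuffle:
  assumes s: "s \<in> shuffles_perm p q"
  shows "\<exists>w. shortest_expression (p + q) (inv s) w"
    and "shortest_expression (p + q) (inv s) w \<Longrightarrow> lowering p (s ` {1..p}) w"
proof -
  define A where "A = s ` {1..p}"
  have A: "A \<subseteq> {1..p + q}" "card A = p" using shuffle_image[OF s] by (auto simp: A_def)
  from lowering_exists[OF A(1)] A(2) obtain v where v: "lowering p A v" by auto
  have v': "inv (word_perm v) \<in> shuffles_perm p q" "inv (word_perm v) ` {1..p} = A" "set v \<subseteq> {1..<p + q}"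
    using lowering_shuffle[OF v A(1)] by auto
  have "inv (word_perm v) = s" using shuffle_eq[OF v'(1) s] v'(2) by (simp add: A_def)
  then have inv_s: "word_perm v = inv s" using inv_inv_eq[OF bij_word_perm[of v]] by simp
  have ge: "length v \<le> length u \<and> (length u = length v \<longrightarrow> lowering p A u)"
    if "set u \<subseteq> {1..<p + q}" "word_perm u = inv s" for u
  proof -
    have "inv (word_perm u) = s"
      unfolding that(2) by (rule permutes_inv_inv) (use s in \<open>auto simp: shuffles_perm_def\<close>)
    moreover have "set u \<subseteq> {1..}" using that(1) by auto
    ultimately show ?thesis
      using word_image_sum[of u p] lowering_sum[OF v] by (simp add: A_def)
  qed
  show "\<exists>w. shortest_expression (p + q) (inv s) w"
    unfolding shortest_expression_def using v'(3) inv_s ge by blast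
  show "lowering p (s ` {1..p}) w" if "shortest_expression (p + q) (inv s) w"
    using that v'(3) inv_s ge[of w] unfolding shortest_expression_def A_def
    by (meson le_antisym)
qed

section \<open>Coshuffles for operators satisfying the braid relations\<close>

definition word_op :: "(nat \<Rightarrow> 'a \<Rightarrow> 'a) \<Rightarrow> nat list \<Rightarrow> 'a \<Rightarrow> 'a" where
  "word_op b w = foldr (\<lambda>i g. b i \<circ> g) w id"

lemma word_op_simps [simp]:
  "word_op b [] x = x" "word_op b (i # w) x = b i (word_op b w x)"
  by (simp_all add: word_op_def)

lemma word_op_append: "word_op b (v @ w) x = word_op b v (word_op b w x)"
  by (induction v) auto

text \<open>
  The recursion separates the shuffles by the block that contains the position mapped to the
  largest value.  The list \<open>[Suc p..<Suc p + Suc q]\<close> is the word of the cycle that carries the last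
  factor to place \<open>p + 1\<close>.
\<close>
fun coshuffle :: "(nat \<Rightarrow> 'a::ab_group_add \<Rightarrow> 'a) \<Rightarrow> nat \<Rightarrow> nat \<Rightarrow> 'a \<Rightarrow> 'a" where
  "coshuffle b 0 q x = x"
| "coshuffle b (Suc p) 0 x = x"
| "coshuffle b (Suc p) (Suc q) x =
     coshuffle b (Suc p) q x + word_op b [Suc p..<Suc p + Suc q] (coshuffle b p (Suc q) x)"

lemma coshuffle_0_right [simp]: "coshuffle b p 0 x = x"
  by (cases p) auto

text \<open>The operator \<open>T\<close> of the inverse of the shuffle with \<open>s{1..p} = A\<close>.\<close>
definition subset_op :: "(nat \<Rightarrow> 'a \<Rightarrow> 'a) \<Rightarrow> nat \<Rightarrow> nat set \<Rightarrow> 'a \<Rightarrow> 'a" where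
  "subset_op b p A = word_op b (SOME w. lowering p A w)"

locale braid_operators =
  fixes M :: "'a::ab_group_add set" and b :: "nat \<Rightarrow> 'a \<Rightarrow> 'a" and n :: nat
  assumes add_closed: "x \<in> M \<Longrightarrow> y \<in> M \<Longrightarrow> x + y \<in> M"
    and additive: "b i (x + y) = b i x + b i y"
    and closed: "1 \<le> i \<Longrightarrow> i < n \<Longrightarrow> x \<in> M \<Longrightarrow> b i x \<in> M"
    and commute: "1 \<le> i \<Longrightarrow> i + 2 \<le> j \<Longrightarrow> j < n \<Longrightarrow> x \<in> M \<Longrightarrow> b i (b j x) = b j (b i x)"
    and braid: "1 \<le> i \<Longrightarrow> Suc i < n \<Longrightarrow> x \<in> M \<Longrightarrow> b i (b (Suc i) (b i x)) = b (Suc i) (b i (b (Suc i) x))"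
begin

lemma word_op_add: "word_op b w (x + y) = word_op b w x + word_op b w y"
  by (induction w) (auto simp: additive)

lemma word_op_sum: "word_op b w (sum f A) = (\<Sum>a\<in>A. word_op b w (f a))"
proof -
  have "word_op b w 0 = 0" using word_op_add[of w 0 0] by simp
  then show ?thesis by (induction A rule: infinite_finite_induct) (auto simp: word_op_add)
qed

lemma word_op_closed: "set w \<subseteq> {1..<n} \<Longrightarrow> x \<in> M \<Longrightarrow> word_op b w x \<in> M"
  by (induction w) (auto simp: closed)

text \<open>
  Diamond argument by induction on the length.  Two lowerings that start with distinct steps at
  \<open>i\<close> and \<open>j\<close> satisfy \<open>\<bar>i - j\<bar> \<ge> 2\<close>, since \<open>i, j \<notin> A\<close> while \<open>i + 1, j + 1 \<in> A\<close>; after both steps they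
  can be completed by a common lowering.
\<close>
lemma word_op_lowering_unique:
  assumes "lowering p A v" "lowering p A w" "A \<subseteq> {1..n}" "x \<in> M"
  shows "word_op b v x = word_op b w x"
  using assms
proof (induction "length v" arbitrary: v w A x)
  case 0
  then have "length w = 0" using lowering_sum[of p A v] lowering_sum[of p A w] by simp
  then show ?case using 0 by simp
next
  case (Suc l)
  have "length w = Suc l"
    using Suc.hyps(2) lowering_sum[OF Suc.prems(1)] lowering_sum[OF Suc.prems(2)] by simp
  let ?A = "\<lambda>i B. insert i (B - {Suc i})"
  from Suc.prems(1) Suc.hyps(2) obtain i v' where v: "v = v' @ [i]" "1 \<le> i" "i \<notin> A" "Suc i \<in> A"
    "lowering p (?A i A) v'" by (cases rule: lowering.cases) auto
  from Suc.prems(2) \<open>length w = Suc l\<close> obtain j w' where w: "w = w' @ [j]" "1 \<le> j" "j \<notin> A" "Suc j \<in> A"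
    "lowering p (?A j A) w'" by (cases rule: lowering.cases) auto
  have l: "length v' = l" "length w' = l" using v(1) w(1) \<open>length w = Suc l\<close> Suc.hyps(2) by auto
  have n: "i < n" "j < n" using v w Suc.prems(3) by auto
  have sub: "?A i A \<subseteq> {1..n}" "?A j A \<subseteq> {1..n}" using n v(2) w(2) Suc.prems(3) by auto
  have M: "b i x \<in> M" "b j x \<in> M" using n v w Suc.prems(4) by (auto intro: closed)
  show ?case
  proof (cases "i = j")
    case True
    have "word_op b v' (b i x) = word_op b w' (b i x)"
      using Suc.hyps(1)[of v' "?A i A" w' "b i x"] l v w True sub M by auto
    then show ?thesis using v w True by (simp add: word_op_append)
  next
    case False
    have far: "i + 2 \<le> j \<or> j + 2 \<le> i"
      using False v(3,4) w(3,4) by (metis add_2_eq_Suc' le_SucE not_less_eq_eq nle_le)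
    have swap: "?A j (?A i A) = ?A i (?A j A)" using far by auto
    have fin: "finite A" using Suc.prems(3) finite_subset by blast
    have "?A j (?A i A) \<subseteq> {1..n}" using sub w(2) n by auto
    from lowering_exists[OF this] obtain u where u: "lowering (card (?A j (?A i A))) (?A j (?A i A)) u" by blast
    have "card (?A j (?A i A)) = card (?A i A)"
      by (rule card_lower) (use far v(3) w(3,4) fin in auto)
    then have "card (?A j (?A i A)) = p" using lowering_card[OF v(5)] by simp
    with u have u: "lowering p (?A j (?A i A)) u" by simp
    have ui: "lowering p (?A i A) (u @ [j])"
      by (rule lowering_step) (use w far u in auto)
    have uj: "lowering p (?A j A) (u @ [i])"
      by (rule lowering_step) (use v far u swap in auto)
    have "word_op b v x = word_op b (u @ [j]) (b i x)"
      using Suc.hyps(1)[OF l(1)[symmetric] v(5) ui sub(1) M(1)] v(1) by (simp add: word_op_append)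
    also have "\<dots> = word_op b u (b j (b i x))" by (simp add: word_op_append)
    also have "b j (b i x) = b i (b j x)"
      using commute[of i j x] commute[of j i x] far n v(2) w(2) Suc.prems(4) by auto
    also have "word_op b u \<dots> = word_op b (u @ [i]) (b j x)" by (simp add: word_op_append)
    also have "\<dots> = word_op b w x"
      using Suc.hyps(1)[OF l(2)[symmetric] w(5) uj sub(2) M(2)] w(1) by (simp add: word_op_append)
    finally show ?thesis .
  qed
qed

lemma subset_op_eq:
  assumes "lowering p A w" "A \<subseteq> {1..n}" "x \<in> M"
  shows "subset_op b p A x = word_op b w x"
  unfolding subset_op_def
  by (rule word_op_lowering_unique[OF someI[of "lowering p A", OF assms(1)] assms])

lemma subset_op_base: "x \<in> M \<Longrightarrow> p \<le> n \<Longrightarrow> subset_op b p {1..p} x = x"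
  using subset_op_eq[OF lowering_base] by simp

lemma subset_op_insert_max:
  assumes "A \<subseteq> {1..l}" "card A = p" "l < n" "x \<in> M"
  shows "subset_op b (Suc p) (insert (Suc l) A) x = word_op b [Suc p..<Suc l] (subset_op b p A x)"
proof -
  from lowering_exists[OF assms(1)] assms(2) obtain w where w: "lowering p A w" by auto
  have "subset_op b (Suc p) (insert (Suc l) A) x = word_op b ([Suc p..<Suc l] @ w) x"
    by (rule subset_op_eq[OF lowering_insert_max[OF w assms(1)]]) (use assms in auto)
  moreover have "subset_op b p A x = word_op b w x"
    by (rule subset_op_eq[OF w]) (use assms in auto)
  ultimately show ?thesis by (simp add: word_op_append del: upt_Suc)
qed

lemma subsets_insert_max:
  "{A. A \<subseteq> {1..Suc l} \<and> card A = Suc p} =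
    {A. A \<subseteq> {1..l} \<and> card A = Suc p} \<union> insert (Suc l) ` {A. A \<subseteq> {1..l} \<and> card A = p}" (is "?L = ?R1 \<union> ?R2")
proof
  show "?L \<subseteq> ?R1 \<union> ?R2"
  proof
    fix A assume A: "A \<in> ?L"
    then have "finite A" using finite_subset by blast
    show "A \<in> ?R1 \<union> ?R2"
    proof (cases "Suc l \<in> A")
      case True
      then have "A = insert (Suc l) (A - {Suc l})" "card (A - {Suc l}) = p"
        using A \<open>finite A\<close> by auto
      moreover have "A - {Suc l} \<subseteq> {1..l}" using A by (auto simp: le_Suc_eq)
      ultimately show ?thesis by blast
    next
      case False
      then show ?thesis using A by (auto simp: le_Suc_eq)
    qed
  qed
  have "card (insert (Suc l) A) = Suc (card A)" if "A \<subseteq> {1..l}" for A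
    using that finite_subset[OF that] by (subst card_insert_disjoint) auto
  then show "?R1 \<union> ?R2 \<subseteq> ?L" by auto
qed

text \<open>The subsets with and without the largest possible element give the two terms of the recursion.\<close>
lemma sum_subset_op:
  assumes "p + q \<le> n" "x \<in> M"
  shows "(\<Sum>A | A \<subseteq> {1..p + q} \<and> card A = p. subset_op b p A x) = coshuffle b p q x"
  using assms(1)
proof (induction "p + q" arbitrary: p q)
  case 0
  have "{A :: nat set. A = {} \<and> card A = 0} = {{}}" by auto
  then show ?case using 0 subset_op_base[of x 0] assms(2) by simp
next
  case (Suc l)
  consider "p = 0" | p' where "p = Suc p'" "q = 0" | p' q' where "p = Suc p'" "q = Suc q'"
    by (cases p; cases q) auto
  then show ?case
  proof cases
    case 1
    have "{A. A \<subseteq> {1..p + q} \<and> card A = p} = {{}}"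
      using 1 by (auto dest: finite_subset)
    then show ?thesis using 1 subset_op_base[of x 0] assms(2) by simp
  next
    case 2
    have "A = {1..p}" if "A \<subseteq> {1..p + q}" "card A = p" for A
      using that 2 card_subset_eq[of "{1..p}" A] by simp
    then have "{A. A \<subseteq> {1..p + q} \<and> card A = p} = {{1..p}}" using 2 by auto
    then show ?thesis using 2 subset_op_base[of x p] assms(2) Suc.prems by simp
  next
    case 3
    define S where "S j = {A. A \<subseteq> {1..l} \<and> card A = j}" for j
    have l: "l = Suc p' + q'" "l = p' + Suc q'" "p + q = Suc l" using 3 Suc.hyps(2) by auto
    have fin: "finite (S j)" for j unfolding S_def by (rule finite_subset[of _ "Pow {1..l}"]) auto
    have "S p \<inter> insert (Suc l) ` S p' = {}" by (auto simp: S_def)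
    moreover have "inj_on (insert (Suc l)) (S p')"
    proof (rule inj_onI)
      fix A B assume "A \<in> S p'" "B \<in> S p'" "insert (Suc l) A = insert (Suc l) B"
      moreover from this have "Suc l \<notin> A" "Suc l \<notin> B" by (auto simp: S_def)
      ultimately show "A = B" by (simp add: insert_ident)
    qed
    ultimately have "(\<Sum>A | A \<subseteq> {1..p + q} \<and> card A = p. subset_op b p A x) =
        (\<Sum>A\<in>S p. subset_op b p A x) + (\<Sum>A\<in>S p'. subset_op b p (insert (Suc l) A) x)"
      using fin subsets_insert_max[of l p'] 3(1) l(3)
      by (simp add: sum.union_disjoint sum.reindex S_def comp_def del: atLeastAtMost_iff)
    also have "(\<Sum>A\<in>S p. subset_op b p A x) = coshuffle b (Suc p') q' x"
      using Suc.hyps(1)[OF l(1)] Suc.prems 3 l(1) by (simp add: S_def)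
    also have "(\<Sum>A\<in>S p'. subset_op b p (insert (Suc l) A) x) =
        (\<Sum>A\<in>S p'. word_op b [Suc p'..<Suc l] (subset_op b p' A x))"
      using subset_op_insert_max[of _ l p' x] Suc.prems l(3) assms(2) 3(1)
      by (intro sum.cong refl) (auto simp: S_def simp del: upt_Suc)
    also have "\<dots> = word_op b [Suc p'..<Suc l] (coshuffle b p' (Suc q') x)"
      using Suc.hyps(1)[OF l(2)] Suc.prems 3 l(2) by (simp add: S_def word_op_sum[symmetric] del: upt_Suc)
    finally show ?thesis using 3 l(1) by (simp del: upt_Suc)
  qed
qed

text \<open>
  Moving \<open>b\<^bsub>j+1\<^esub>\<close> through \<open>b\<^sub>k \<dots> b\<^sub>l\<close> meets a braid relation only at \<open>b\<^sub>j b\<^bsub>j+1\<^esub>\<close>, where it turns into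
  \<open>b\<^sub>j\<close>; all other letters are distant.
\<close>
lemma word_op_shift:
  assumes "1 \<le> k" "k \<le> j" "Suc j \<le> l" "l < n" "x \<in> M"
  shows "b (Suc j) (word_op b [k..<Suc l] x) = word_op b [k..<Suc l] (b j x)"
proof -
  have up: "[k..<Suc l] = [k..<j] @ [j, Suc j] @ [Suc (Suc j)..<Suc l]"
  proof -
    have "[k..<Suc l] = [k..<j] @ [j..<Suc l]"
      using assms upt_add_eq_append[of k j "Suc l - j"] by simp
    moreover have "[j..<Suc l] = j # Suc j # [Suc (Suc j)..<Suc l]"
      using assms by (simp add: upt_conv_Cons del: upt_Suc)
    ultimately show ?thesis by simp
  qed
  have left: "word_op b w (b (Suc j) y) = b (Suc j) (word_op b w y)"
    if "set w \<subseteq> {k..<j}" "y \<in> M" for w y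
    using that(1)
  proof (induction w)
    case (Cons i w)
    have "word_op b w y \<in> M" using that(2) assms Cons.prems by (intro word_op_closed) auto
    then show ?case using Cons commute[of i "Suc j"] assms by auto
  qed simp
  have right: "word_op b w (b j y) = b j (word_op b w y)"
    if "set w \<subseteq> {Suc (Suc j)..<Suc l}" "y \<in> M" for w y
    using that(1)
  proof (induction w)
    case (Cons i w)
    have "word_op b w y \<in> M" using that(2) assms Cons.prems by (intro word_op_closed) auto
    then show ?case using Cons commute[of j i] assms by auto
  qed simp
  define y where "y = word_op b [Suc (Suc j)..<Suc l] x"
  have y: "y \<in> M" unfolding y_def using assms by (intro word_op_closed) auto
  have "b j (b (Suc j) y) \<in> M" using y assms by (intro closed) auto
  then have "b (Suc j) (word_op b [k..<Suc l] x) = word_op b [k..<j] (b (Suc j) (b j (b (Suc j) y)))"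
    unfolding up by (simp add: word_op_append y_def[symmetric] left del: upt_Suc)
  also have "\<dots> = word_op b [k..<j] (b j (b (Suc j) (b j y)))"
    using braid[of j y] y assms by simp
  also have "\<dots> = word_op b [k..<Suc l] (b j x)"
    unfolding up by (simp add: word_op_append y_def right assms(5) del: upt_Suc)
  finally show ?thesis .
qed

end

lemma word_op_intertwine:
  assumes "\<And>i x. i \<in> set w \<Longrightarrow> x \<in> M \<Longrightarrow> E (b i x) = b' i (E x)"
    and "\<And>i x. i \<in> set w \<Longrightarrow> x \<in> M \<Longrightarrow> b i x \<in> M" and "x \<in> M"
  shows "E (word_op b w x) = word_op b' w (E x) \<and> word_op b w x \<in> M"
  using assms by (induction w) auto

text \<open>
  The map \<open>E\<close> may be a commuting operator, a contraction that changes the degree or, with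
  \<open>b' = (\<lambda>i y. - y)\<close>, a contraction that turns all operators into signs.  Closure of \<open>M\<close> is carried
  along in the induction, since the intertwining property is only known on \<open>M\<close>.
\<close>
lemma coshuffle_intertwine:
  fixes E :: "'a::ab_group_add \<Rightarrow> 'b::ab_group_add"
  assumes "\<And>x y. x \<in> M \<Longrightarrow> y \<in> M \<Longrightarrow> x + y \<in> M"
    and "\<And>x y. E (x + y) = E x + E y"
    and "\<And>i x. 1 \<le> i \<Longrightarrow> i < p + q \<Longrightarrow> x \<in> M \<Longrightarrow> E (b i x) = b' i (E x)"
    and "\<And>i x. 1 \<le> i \<Longrightarrow> i < p + q \<Longrightarrow> x \<in> M \<Longrightarrow> b i x \<in> M" and "x \<in> M"
  shows "E (coshuffle b p q x) = coshuffle b' p q (E x) \<and> coshuffle b p q x \<in> M"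
  using assms
proof (induction b p q x rule: coshuffle.induct)
  case (3 b p q x)
  have IH: "E (coshuffle b (Suc p) q x) = coshuffle b' (Suc p) q (E x) \<and> coshuffle b (Suc p) q x \<in> M"
      "E (coshuffle b p (Suc q) x) = coshuffle b' p (Suc q) (E x) \<and> coshuffle b p (Suc q) x \<in> M"
    using 3 by simp_all
  have "E (word_op b [Suc p..<Suc p + Suc q] (coshuffle b p (Suc q) x)) =
      word_op b' [Suc p..<Suc p + Suc q] (E (coshuffle b p (Suc q) x)) \<and>
      word_op b [Suc p..<Suc p + Suc q] (coshuffle b p (Suc q) x) \<in> M"
    using 3(5,6) IH(2) by (intro word_op_intertwine) auto
  then show ?case using IH 3(3,4) by (simp del: upt_Suc)
qed simp_all

lemma coshuffle_add:
  assumes "\<And>i x y. b i (x + y) = b i x + b i y"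
  shows "coshuffle b p q (x + y) = coshuffle b p q x + coshuffle b p q y"
proof -
  have w: "word_op b w (x + y) = word_op b w x + word_op b w y" for w x y
    by (induction w) (auto simp: assms)
  show ?thesis
  proof (induction "p + q" arbitrary: p q rule: less_induct)
    case less
    then show ?case
      by (cases p; cases q) (simp_all add: w add_ac del: upt_Suc)
  qed
qed

lemma word_op_shift_index: "word_op (\<lambda>i. b (k + i)) [i..<j] x = word_op b [k + i..<k + j] x"
  by (induction j arbitrary: x) (auto simp: word_op_append)

text \<open>
  Expand the outer coshuffle on both sides by the recursion.  On the right, with
  \<open>T = k + m + r\<close>, the factor \<open>b\<^bsub>k+m\<^esub> \<dots> b\<^bsub>T-1\<^esub>\<close> commutes with the coshuffles of \<open>(k, m - 1)\<close> and
  \<open>(k - 1, m)\<close>, which involve only the first \<open>k + m - 1\<close> factors.  On the left, \<open>b\<^sub>k \<dots> b\<^bsub>T-1\<^esub>\<close> is moved out by naturality.  This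
  leaves the same three terms on both sides, by the induction hypotheses for \<open>(k, m, r - 1)\<close>,
  \<open>(k, m - 1, r)\<close> and \<open>(k - 1, m, r)\<close>.
\<close>
lemma (in braid_operators) coshuffle_coassoc:
  assumes "k + m + r \<le> n" "x \<in> M"
  shows "coshuffle (\<lambda>i. b (k + i)) m r (coshuffle b k (m + r) x) =
    coshuffle b k m (coshuffle b (k + m) r x)"
  using assms(1)
proof (induction "k + m + r" arbitrary: k m r rule: less_induct)
  case less
  consider "k = 0" | "m = 0" | "r = 0" | k' m' r' where "k = Suc k'" "m = Suc m'" "r = Suc r'"
    by (cases k; cases m; cases r) auto
  then show ?case
  proof cases
    case 4
    define T where "T = k + m + r"
    define W where "W i j = word_op b [i..<j]" for i j
    define c where "c = (\<lambda>i. b (k + i))"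
    define c' where "c' = (\<lambda>i. b (k' + i))"
    have T: "T \<le> n" using less.prems by (simp add: T_def)
    have W_add: "W i j (y + z) = W i j y + W i j z" for i j y z
      by (simp add: W_def word_op_add)
    have c_add: "c i (y + z) = c i y + c i z" for i y z by (simp add: c_def additive)
    have b_rec: "coshuffle b (Suc p) (Suc q) y =
        coshuffle b (Suc p) q y + W (Suc p) (Suc p + Suc q) (coshuffle b p (Suc q) y)" for p q y
      by (simp add: W_def del: upt_Suc)
    have "word_op c [Suc m'..<Suc m' + Suc r'] y = W (k + m) T y" for y
      unfolding c_def word_op_shift_index by (simp add: W_def 4 T_def add.assoc del: upt_Suc)
    then have c_rec: "coshuffle c m r y = coshuffle c m r' y + W (k + m) T (coshuffle c m' r y)" for y
      unfolding 4 coshuffle.simps(3) by (simp only:)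
    have W_comp: "W k (k + m) (W (k + m) T y) = W k T y" for y
    proof -
      have "[k..<T] = [k..<k + m] @ [k + m..<T]"
        using upt_add_eq_append[of k "k + m" r] by (simp add: T_def)
      then show ?thesis by (simp add: W_def word_op_append)
    qed
    have closed': "coshuffle b p q x \<in> M" if "p + q \<le> n" for p q
      using coshuffle_intertwine[of M id p q b b x] that add_closed closed assms(2) by simp
    have far: "coshuffle b p q (W (k + m) T y) = W (k + m) T (coshuffle b p q y)"
      if "p + q < k + m" "y \<in> M" for p q y
    proof -
      have "W (k + m) T (b i z) = b i (W (k + m) T z)" if "1 \<le> i" "i < p + q" "z \<in> M" for i z
      proof -
        have "b i (word_op b [k + m..<T] z) = word_op (\<lambda>i. b i) [k + m..<T] (b i z) \<and>
            word_op b [k + m..<T] z \<in> M"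
        proof (rule word_op_intertwine)
          fix j y assume "j \<in> set [k + m..<T]" "y \<in> M"
          then show "b i (b j y) = b j (b i y)"
            using commute[of i j y] that(1,2) \<open>p + q < k + m\<close> T by auto
        next
          fix j y assume "j \<in> set [k + m..<T]" "y \<in> M"
          then show "b j y \<in> M" using closed[of j y] T 4(1) by auto
        qed (rule that(3))
        then show ?thesis by (simp add: W_def)
      qed
      then show ?thesis
        using coshuffle_intertwine[of M "W (k + m) T" p q b b y] add_closed W_add closed that T
        by (simp add: T_def)
    qed
    have shift: "coshuffle c m r (W k T z) = W k T (coshuffle c' m r z)" if "z \<in> M" for z
    proof -
      have "W k T (c' i y) = c i (W k T y)" if "1 \<le> i" "i < m + r" "y \<in> M" for i y
        using word_op_shift[of k "k' + i" "T - 1" y] that 4 T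
        by (simp add: W_def c_def c'_def T_def)
      moreover have "c' i y \<in> M" if "1 \<le> i" "i < m + r" "y \<in> M" for i y
        using closed[of "k' + i" y] that 4 T by (simp add: c'_def T_def)
      ultimately show ?thesis
        using coshuffle_intertwine[of M "W k T" m r c' c z] add_closed W_add that by simp
    qed
    have IH1: "coshuffle b k m (coshuffle b (k + m) r' x) = coshuffle c m r' (coshuffle b k (m + r') x)"
      using less.hyps[of k m r'] less.prems 4 by (simp add: c_def)
    have IH2: "coshuffle b k m' (coshuffle b (k + m') r x) = coshuffle c m' r (coshuffle b k (m' + r) x)"
      using less.hyps[of k m' r] less.prems 4 by (simp add: c_def)
    have IH3: "coshuffle b k' m (coshuffle b (k' + m) r x) = coshuffle c' m r (coshuffle b k' (m + r) x)"
      using less.hyps[of k' m r] less.prems 4 by (simp add: c'_def)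
    define y where "y = coshuffle b (k' + m) r x"
    have y: "y \<in> M" unfolding y_def by (rule closed') (use less.prems 4 in auto)
    define u where "u = coshuffle b k (m' + r) x"
    define z where "z = coshuffle b k' (m + r) x"
    have z: "z \<in> M" unfolding z_def by (rule closed') (use less.prems 4 in auto)
    have "coshuffle b (k + m) r x = coshuffle b (k + m) r' x + W (k + m) T y"
      using b_rec[of "k' + m" r' x] 4 by (simp add: T_def y_def add.assoc)
    then have "coshuffle b k m (coshuffle b (k + m) r x) =
        coshuffle b k m (coshuffle b (k + m) r' x) + coshuffle b k m (W (k + m) T y)"
      by (simp add: coshuffle_add additive)
    also have "coshuffle b k m (W (k + m) T y) =
        coshuffle b k m' (W (k + m) T y) + W k (k + m) (coshuffle b k' m (W (k + m) T y))"
      using b_rec[of k' m'] 4 by simp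
    also have "\<dots> = W (k + m) T (coshuffle b k m' y) + W k T (coshuffle b k' m y)"
    proof -
      have "coshuffle b k m' (W (k + m) T y) = W (k + m) T (coshuffle b k m' y)"
        by (rule far) (use y 4 in auto)
      moreover have "coshuffle b k' m (W (k + m) T y) = W (k + m) T (coshuffle b k' m y)"
        by (rule far) (use y 4 in auto)
      ultimately show ?thesis by (simp only: W_comp)
    qed
    also have "coshuffle b k m' y = coshuffle c m' r u"
      using IH2 4 by (simp add: y_def u_def)
    also have "coshuffle b k' m y = coshuffle c' m r z"
      using IH3 by (simp add: y_def z_def)
    also have "coshuffle b k m (coshuffle b (k + m) r' x) = coshuffle c m r' u"
      using IH1 4 by (simp add: u_def)
    finally have rhs: "coshuffle b k m (coshuffle b (k + m) r x) =
        coshuffle c m r' u + (W (k + m) T (coshuffle c m' r u) + W k T (coshuffle c' m r z))" .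
    have "coshuffle b k (m + r) x = u + W k T z"
      using b_rec[of k' "m' + r" x] 4 by (simp add: T_def u_def z_def add.assoc)
    then have "coshuffle c m r (coshuffle b k (m + r) x) = coshuffle c m r u + W k T (coshuffle c' m r z)"
      using shift[OF z] by (simp add: coshuffle_add c_add)
    then show ?thesis
      unfolding c_def[symmetric] rhs by (simp add: c_rec add.assoc)
  qed simp_all
qed

section \<open>The quantum binomial coefficient at minus one\<close>

lemma binomial_minus_one_commute: "binomial_minus_one m k = binomial_minus_one k m"
proof (cases "even (m * k)")
  case True
  then have "(m + k) div 2 = m div 2 + k div 2" by (auto elim!: evenE)
  then show ?thesis
    using binomial_symmetric[of "k div 2" "m div 2 + k div 2"]
    by (simp add: binomial_minus_one_def ac_simps)
qed (simp add: binomial_minus_one_def mult.commute)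

lemma binomial_minus_one_0 [simp]: "binomial_minus_one 0 q = 1" "binomial_minus_one p 0 = 1"
  by (simp_all add: binomial_minus_one_def)

lemma binomial_minus_one_parity:
  "binomial_minus_one (2 * a) (2 * b) = (a + b) choose b"
  "binomial_minus_one (2 * a) (Suc (2 * b)) = (a + b) choose b"
  "binomial_minus_one (Suc (2 * a)) (2 * b) = (a + b) choose b"
  "binomial_minus_one (Suc (2 * a)) (Suc (2 * b)) = 0"
proof -
  have "(2 * a + 2 * b) div 2 = a + b" "(2 * a + Suc (2 * b)) div 2 = a + b"
    "(Suc (2 * a) + 2 * b) div 2 = a + b" "Suc (2 * b) div 2 = b" by presburger+
  then show "binomial_minus_one (2 * a) (2 * b) = (a + b) choose b"
    "binomial_minus_one (2 * a) (Suc (2 * b)) = (a + b) choose b"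
    "binomial_minus_one (Suc (2 * a)) (2 * b) = (a + b) choose b"
    "binomial_minus_one (Suc (2 * a)) (Suc (2 * b)) = 0"
    by (simp_all only: binomial_minus_one_def) simp_all
qed

text \<open>
  The recursion of the Gaussian binomial coefficients at \<open>-1\<close>.  In each parity case one of the
  three coefficients vanishes or the signs cancel two equal ones, except when \<open>p\<close> and \<open>q\<close> are
  odd, where this is Pascal's rule.
\<close>
lemma binomial_minus_one_rec:
  "(of_nat (binomial_minus_one (Suc p) (Suc q)) :: 'a::comm_ring_1) =
    of_nat (binomial_minus_one (Suc p) q) + (- 1) ^ Suc q * of_nat (binomial_minus_one p (Suc q))"
proof -
  have "p = 2 * (p div 2) \<or> p = Suc (2 * (p div 2))" "q = 2 * (q div 2) \<or> q = Suc (2 * (q div 2))"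
    by presburger+
  then obtain a b where "p = 2 * a \<or> p = Suc (2 * a)" and "q = 2 * b \<or> q = Suc (2 * b)"
    by blast
  moreover have "Suc (Suc (2 * c)) = 2 * Suc c" for c :: nat by simp
  moreover have "(- 1 :: 'a) ^ (2 * c) = 1" for c by simp
  ultimately show ?thesis
    by (elim disjE) (simp_all only: binomial_minus_one_parity power_Suc, simp_all)
qed

lemma tscale_1 [simp]: "tscale 1 x = x" by (simp add: tscale_def)
lemma tscale_tscale [simp]: "tscale a (tscale b x) = tscale (a * b) x" by (simp add: tscale_def mult.assoc)
lemma uminus_tensor: "- x = tscale (- 1) (x :: ('v, 'k::field) tensor)" by (simp add: tscale_def fun_eq_iff)

text \<open>When every operator is the sign \<open>-1\<close>, the coshuffle counts the shuffles with their signs.\<close>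
lemma coshuffle_uminus:
  "coshuffle (\<lambda>i x. - x) p q x = tscale (of_nat (binomial_minus_one p q)) (x :: ('v, 'k::field) tensor)"
proof -
  have w: "word_op (\<lambda>i x. - x) w x = tscale ((- 1) ^ length w) (x :: ('v, 'k) tensor)" for w x
    by (induction w) (simp_all add: uminus_tensor)
  show ?thesis
  proof (induction "p + q" arbitrary: p q rule: less_induct)
    case less
    show ?case
    proof (cases "p = 0 \<or> q = 0")
      case False
      then obtain p' q' where "p = Suc p'" "q = Suc q'" by (metis not0_implies_Suc)
      moreover have "tscale a x + tscale b x = tscale (a + b) x" for a b
        by (simp add: tscale_def fun_eq_iff algebra_simps)
      ultimately show ?thesis
        using less.hyps[of p q'] less.hyps[of p' q]
        by (simp add: w binomial_minus_one_rec del: upt_Suc power_Suc)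
    qed auto
  qed
qed

section \<open>Linear maps and forms on tensor powers\<close>

lemma linear_tensor_map_iff:
  "Vector_Spaces.linear tscale tscale (\<Phi> :: ('v, 'k::field) tensor \<Rightarrow> ('w, 'k) tensor) \<longleftrightarrow>
    (\<forall>x y. \<Phi> (x + y) = \<Phi> x + \<Phi> y) \<and> (\<forall>c x. \<Phi> (tscale c x) = tscale c (\<Phi> x))"
  by (rule linear_iff) (rule vector_space_tscale)+

text \<open>
  A lifted map is linear on all functionals, not only on tensors, since it evaluates pointwise.
  Identities between such maps on a tensor power can therefore be checked on pure tensors.
\<close>
lemma linear_tlift: "Vector_Spaces.linear tscale tscale (tlift g)"
  by (auto simp: linear_tensor_map_iff tlift_def tscale_def fun_eq_iff)

lemma linear_at_pos: "Vector_Spaces.linear tscale tscale (at_pos scale l r \<phi> i)"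
  unfolding at_pos_def by (rule linear_tlift)

lemma linear_contract_left: "Vector_Spaces.linear tscale tscale (contract_left scale \<epsilon> k)"
  unfolding contract_left_def by (rule linear_tlift)

lemma linear_contract_right: "Vector_Spaces.linear tscale tscale (contract_right scale \<epsilon> p)"
  unfolding contract_right_def by (rule linear_tlift)

lemma linear_tsandwich: "Vector_Spaces.linear tscale tscale (\<lambda>y. tsandwich scale r us y ws)"
  by (auto simp: linear_tensor_map_iff tsandwich_def tscale_def fun_eq_iff)

lemmas linear_comp = Vector_Spaces.linear_compose[unfolded comp_def]

lemma linear_tensor_mapD:
  assumes "Vector_Spaces.linear tscale tscale (\<Phi> :: ('v, 'k::field) tensor \<Rightarrow> ('w, 'k) tensor)"
  shows "\<Phi> (x + y) = \<Phi> x + \<Phi> y" "\<Phi> (tscale c x) = tscale c (\<Phi> x)"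
  using assms by (auto simp: linear_tensor_map_iff)

lemma linear_tscale_map:
  assumes "Vector_Spaces.linear tscale tscale (\<Phi> :: ('v, 'k::field) tensor \<Rightarrow> ('w, 'k) tensor)"
  shows "Vector_Spaces.linear tscale tscale (\<lambda>x. tscale c (\<Phi> x))"
  using assms by (auto simp: linear_tensor_map_iff) (auto simp: tscale_def fun_eq_iff algebra_simps)

lemma tens_in_tensor_power:
  fixes scale :: "'k::field \<Rightarrow> 'v::ab_group_add \<Rightarrow> 'v"
  assumes "length vs = n"
  shows "tens scale vs \<in> tensor_power scale n"
proof -
  interpret T: vector_space "tscale :: 'k \<Rightarrow> ('v, 'k) tensor \<Rightarrow> _" by (rule vector_space_tscale)
  show ?thesis
    unfolding tensor_power_def by (rule T.span_base) (use assms in auto)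
qed

lemma tensor_power_closed:
  fixes scale :: "'k::field \<Rightarrow> 'v::ab_group_add \<Rightarrow> 'v"
  shows "0 \<in> tensor_power scale n"
    and "x \<in> tensor_power scale n \<Longrightarrow> y \<in> tensor_power scale n \<Longrightarrow> x + y \<in> tensor_power scale n"
    and "x \<in> tensor_power scale n \<Longrightarrow> tscale c x \<in> tensor_power scale n"
proof -
  interpret T: vector_space "tscale :: 'k \<Rightarrow> ('v, 'k) tensor \<Rightarrow> _" by (rule vector_space_tscale)
  show "0 \<in> tensor_power scale n"
    and "x \<in> tensor_power scale n \<Longrightarrow> y \<in> tensor_power scale n \<Longrightarrow> x + y \<in> tensor_power scale n"
    and "x \<in> tensor_power scale n \<Longrightarrow> tscale c x \<in> tensor_power scale n"
    unfolding tensor_power_def by (auto intro: T.span_zero T.span_add T.span_scale)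
qed

lemma tensor_power_induct [consumes 1, case_names tens zero add scale]:
  fixes scale :: "'k::field \<Rightarrow> 'v::ab_group_add \<Rightarrow> 'v"
  assumes "x \<in> tensor_power scale n"
    and "\<And>vs. length vs = n \<Longrightarrow> P (tens scale vs)"
    and "P 0" "\<And>x y. P x \<Longrightarrow> P y \<Longrightarrow> P (x + y)" "\<And>c x. P x \<Longrightarrow> P (tscale c x)"
  shows "P x"
proof -
  interpret T: vector_space "tscale :: 'k \<Rightarrow> ('v, 'k) tensor \<Rightarrow> _" by (rule vector_space_tscale)
  show ?thesis using assms(1) unfolding tensor_power_def
  proof (induction rule: T.span_induct)
    case base
    show ?case using assms(3-5) by (auto simp: T.subspace_def)
  next
    case (step x)
    then show ?case using assms(2) by auto
  qed
qed

lemma linear_into_tensor_power: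
  assumes "Vector_Spaces.linear tscale tscale \<Phi>"
    and "\<And>vs. length vs = n \<Longrightarrow> \<Phi> (tens scale vs) \<in> tensor_power scale r"
    and "x \<in> tensor_power scale n"
  shows "\<Phi> x \<in> tensor_power scale r"
  using assms(3)
proof (induction rule: tensor_power_induct)
  case zero
  have "\<Phi> (tscale 0 0) = tscale 0 (\<Phi> 0)" by (rule linear_tensor_mapD(2)[OF assms(1)])
  moreover have z: "tscale 0 y = 0" for y by (simp add: tscale_def fun_eq_iff)
  ultimately have "\<Phi> 0 = 0" unfolding z by simp
  then show ?case by (simp only: tensor_power_closed(1))
next
  case (add x y)
  then show ?case unfolding linear_tensor_mapD(1)[OF assms(1)] by (rule tensor_power_closed(2))
next
  case (scale c x)
  then show ?case unfolding linear_tensor_mapD(2)[OF assms(1)] by (rule tensor_power_closed(3))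
qed (rule assms(2))

lemma tsandwich_in_tensor_power:
  assumes "y \<in> tensor_power scale r"
  shows "tsandwich scale r us y ws \<in> tensor_power scale (length us + r + length ws)"
  using linear_tsandwich _ assms
proof (rule linear_into_tensor_power)
  fix vs :: "'a list" assume "length vs = r"
  then show "tsandwich scale r us (tens scale vs) ws \<in> tensor_power scale (length us + r + length ws)"
    using tsandwich_tens[of scale vs us ws] by (simp add: tens_in_tensor_power)
qed

lemma tsandwich_nest:
  assumes "r = length us' + r' + length ws'"
  shows "tsandwich scale r us (tsandwich scale r' us' y ws') ws = tsandwich scale r' (us @ us') y (ws' @ ws)"
proof
  fix f
  show "tsandwich scale r us (tsandwich scale r' us' y ws') ws f = tsandwich scale r' (us @ us') y (ws' @ ws) f"
  proof (cases "multilinear scale (*) (length us + r + length ws) f")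
    case True
    then show ?thesis
      using multilinear_middle[OF True] assms by (simp add: tsandwich_def add.assoc)
  next
    case False
    then show ?thesis using assms by (simp add: tsandwich_def add.assoc)
  qed
qed

lemma multilinear_cong:
  assumes "\<And>vs. length vs = n \<Longrightarrow> f vs = g vs"
  shows "multilinear scale scaleW n f = multilinear scale scaleW n g"
  using assms by (simp add: multilinear_def)

text \<open>
  Tensors are functionals on functions of lists of any length, but one of degree \<open>n\<close> only sees the
  values at lists of length \<open>n\<close>.
\<close>
lemma tensor_cong:
  assumes "x \<in> tensor_power scale n" "\<And>vs. length vs = n \<Longrightarrow> f vs = g vs"
  shows "x f = x g"
  using assms(1)
proof (induction rule: tensor_power_induct)
  case (tens vs)
  then show ?case using assms(2) multilinear_cong[of n f g scale "(*)"] by (simp add: tens_def)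
qed (simp_all add: tscale_def)

lemma tensor_zero_form:
  assumes "x \<in> tensor_power scale n"
  shows "x (\<lambda>_. 0) = 0"
  using assms by (induction rule: tensor_power_induct) (simp_all add: tscale_def tens_def)

text \<open>Evaluating \<open>y\<close> in some of the arguments of a multilinear form leaves a multilinear form.\<close>
lemma multilinear_evaluate:
  fixes scale :: "'k::field \<Rightarrow> 'v::ab_group_add \<Rightarrow> 'v"
  assumes V: "vector_space scale" and y: "y \<in> tensor_power scale s"
    and H: "\<And>ws. length ws = s \<Longrightarrow> multilinear scale (*) r (\<lambda>vs. H vs ws)"
      "\<And>vs. length vs = r \<Longrightarrow> multilinear scale (*) s (H vs)"
  shows "multilinear scale (*) r (\<lambda>vs. y (H vs))"
  unfolding multilinear_def
proof (intro allI impI)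
  fix vs :: "'v list" and i assume vs: "length vs = r \<and> i < r"
  show "Vector_Spaces.linear scale (*) (\<lambda>u. y (H (vs[i := u])))"
    by (rule linear_tensor_param[OF V y]) (use vs H in \<open>auto simp: multilinear_def\<close>)
qed

lemma tensor_form_add:
  fixes scale :: "'k::field \<Rightarrow> 'v::ab_group_add \<Rightarrow> 'v"
  assumes V: "vector_space scale" and x: "x \<in> tensor_power scale n"
    and f: "multilinear scale (*) n f" and g: "multilinear scale (*) n g"
  shows "x (\<lambda>vs. f vs + g vs) = x f + x g"
  using x
proof (induction rule: tensor_power_induct)
  case (tens vs)
  have "multilinear scale (*) n (\<lambda>vs. f vs + g vs)"
    using f g by (simp add: multilinear_def linear_iff[OF V vector_space_mult] algebra_simps)
  then show ?case using f g tens by (simp add: tens_def)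
qed (simp_all add: tscale_def algebra_simps)

lemma tensor_form_scale:
  fixes scale :: "'k::field \<Rightarrow> 'v::ab_group_add \<Rightarrow> 'v"
  assumes V: "vector_space scale" and x: "x \<in> tensor_power scale n"
    and f: "multilinear scale (*) n f"
  shows "x (\<lambda>vs. c * f vs) = c * x f"
  using x
proof (induction rule: tensor_power_induct)
  case (tens vs)
  have "multilinear scale (*) n (\<lambda>vs. c * f vs)"
    using f by (simp add: multilinear_def linear_iff[OF V vector_space_mult] algebra_simps)
  then show ?case using f tens by (simp add: tens_def)
qed (simp_all add: tscale_def algebra_simps)

text \<open>
  Evaluating two tensors in disjoint groups of arguments of one form can be done in either order.
  This is the reason why operators at distant positions commute.
\<close>
lemma tensor_fubini:
  fixes scale :: "'k::field \<Rightarrow> 'v::ab_group_add \<Rightarrow> 'v"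
  assumes V: "vector_space scale"
    and x: "x \<in> tensor_power scale r" and y: "y \<in> tensor_power scale s"
    and H: "\<And>vs. length vs = r \<Longrightarrow> multilinear scale (*) s (H vs)"
      "\<And>ws. length ws = s \<Longrightarrow> multilinear scale (*) r (\<lambda>vs. H vs ws)"
  shows "x (\<lambda>vs. y (H vs)) = y (\<lambda>ws. x (\<lambda>vs. H vs ws))"
proof -
  have "x (\<lambda>vs. y (H vs)) = y (\<lambda>ws. x (\<lambda>vs. H vs ws)) \<and>
      multilinear scale (*) s (\<lambda>ws. x (\<lambda>vs. H vs ws))"
    using x
  proof (induction rule: tensor_power_induct)
    case (tens vs)
    have *: "tens scale vs (\<lambda>vs. H vs ws) = H vs ws" if "length ws = s" for ws
      using H(2)[OF that] tens by (simp add: tens_def)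
    have "tens scale vs (\<lambda>vs. y (H vs)) = y (H vs)"
      using multilinear_evaluate[OF V y H(2,1)] tens by (simp add: tens_def)
    also have "\<dots> = y (\<lambda>ws. tens scale vs (\<lambda>vs. H vs ws))"
      using y by (rule tensor_cong) (simp add: *)
    finally show ?case
      using H(1)[OF tens] multilinear_cong[of s "\<lambda>ws. tens scale vs (\<lambda>vs. H vs ws)" "H vs" scale "(*)"] *
      by simp
  next
    case zero
    have "multilinear scale (*) s (\<lambda>ws. 0 :: 'k)"
      by (simp add: multilinear_def linear_iff[OF V vector_space_mult])
    then show ?case using tensor_zero_form[OF y] by simp
  next
    case (add x z)
    then have "multilinear scale (*) s (\<lambda>ws. x (\<lambda>vs. H vs ws) + z (\<lambda>vs. H vs ws))"
      by (simp add: multilinear_def linear_iff[OF V vector_space_mult] algebra_simps)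
    then show ?case using add tensor_form_add[OF V y] by simp
  next
    case (scale c x)
    then have "multilinear scale (*) s (\<lambda>ws. c * x (\<lambda>vs. H vs ws))"
      by (simp add: multilinear_def linear_iff[OF V vector_space_mult] algebra_simps)
    then show ?case using scale tensor_form_scale[OF V y] by (simp add: tscale_def)
  qed
  then show ?thesis ..
qed

text \<open>
  A linear map is determined on \<open>u\<^sub>1 \<otimes> \<dots> \<otimes> y \<otimes> \<dots> \<otimes> w\<^sub>q\<close> by its values on pure tensors: these are
  multilinear in the middle arguments, and \<open>y\<close> can be evaluated at that form.
\<close>
lemma linear_map_tsandwich:
  fixes scale :: "'k::field \<Rightarrow> 'v::ab_group_add \<Rightarrow> 'v" and \<Phi> :: "('v, 'k) tensor \<Rightarrow> ('w, 'k) tensor"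
  assumes V: "vector_space scale" and \<Phi>: "Vector_Spaces.linear tscale tscale \<Phi>"
    and y: "y \<in> tensor_power scale r"
  shows "\<Phi> (tsandwich scale r us y ws) f = y (\<lambda>vs. \<Phi> (tens scale (us @ vs @ ws)) f)"
  using linear_comp[OF linear_comp[OF linear_tsandwich \<Phi>] linear_tensor_apply] linear_tensor_apply _ y
proof (rule tensor_power_linear_eq)
  fix vs :: "'v list" assume vs: "length vs = r"
  have "multilinear scale (*) (length us + r + length ws) (\<lambda>xs. \<Phi> (tens scale xs) f)"
    by (rule multilinear_compose[OF multilinear_compose[OF multilinear_tens[OF V] \<Phi>] linear_tensor_apply])
  from multilinear_middle[OF this] vs
  show "\<Phi> (tsandwich scale r us (tens scale vs) ws) f =
      tens scale vs (\<lambda>vs. \<Phi> (tens scale (us @ vs @ ws)) f)"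
    using tsandwich_tens[of scale vs us ws] by (simp add: tens_def[of scale vs])
qed

lemma multilinear_tensor_iff:
  fixes scale :: "'k::field \<Rightarrow> 'v::ab_group_add \<Rightarrow> 'v" and g :: "'v list \<Rightarrow> ('w, 'k) tensor"
  assumes "vector_space scale"
  shows "multilinear scale tscale n g \<longleftrightarrow> (\<forall>f. multilinear scale (*) n (\<lambda>vs. g vs f))"
  unfolding multilinear_def linear_tensor_iff[OF assms] by blast

lemma multilinear_split:
  fixes scale :: "'k::field \<Rightarrow> 'v::ab_group_add \<Rightarrow> 'v"
  assumes V: "vector_space scale" and F: "multilinear scale (*) p F" and G: "multilinear scale (*) q G"
  shows "multilinear scale (*) (p + q) (\<lambda>vs. F (take p vs) * G (drop p vs))"
  unfolding multilinear_def
proof (intro allI impI)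
  fix vs :: "'v list" and i assume vs: "length vs = p + q \<and> i < p + q"
  note lin = linear_iff[OF V vector_space_mult]
  show "Vector_Spaces.linear scale (*) (\<lambda>u. F (take p (vs[i := u])) * G (drop p (vs[i := u])))"
  proof (cases "i < p")
    case True
    have "Vector_Spaces.linear scale (*) (\<lambda>u. F ((take p vs)[i := u]))"
      using F vs True by (simp add: multilinear_def)
    then show ?thesis using True by (simp add: lin take_update_swap algebra_simps)
  next
    case False
    have "Vector_Spaces.linear scale (*) (\<lambda>u. G ((drop p vs)[i - p := u]))"
      using G[unfolded multilinear_def, rule_format, of "drop p vs" "i - p"] vs False by auto
    then show ?thesis using False by (simp add: lin drop_update_swap algebra_simps)
  qed
qed

lemma multilinear_character:
  fixes scale :: "'k::field \<Rightarrow> 'v::ab_group_add \<Rightarrow> 'v"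
  assumes V: "vector_space scale" and \<epsilon>: "Vector_Spaces.linear scale (*) \<epsilon>"
  shows "multilinear scale (*) n (\<lambda>vs. \<Prod>v\<leftarrow>vs. \<epsilon> v)"
  unfolding multilinear_def
proof (intro allI impI)
  fix vs :: "'v list" and i assume "length vs = n \<and> i < n"
  then show "Vector_Spaces.linear scale (*) (\<lambda>u. \<Prod>v\<leftarrow>vs[i := u]. \<epsilon> v)"
    using \<epsilon> by (simp add: linear_iff[OF V vector_space_mult] upd_conv_take_nth_drop algebra_simps)
qed

lemma linear_tensor_id: "Vector_Spaces.linear tscale tscale (\<lambda>x. x :: ('v, 'k::field) tensor)"
  by (simp add: linear_tensor_map_iff)

lemma contract_left_append:
  fixes scale :: "'k::field \<Rightarrow> 'v::ab_group_add \<Rightarrow> 'v"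
  assumes V: "vector_space scale" and \<epsilon>: "Vector_Spaces.linear scale (*) \<epsilon>" and us: "length us = k"
  shows "contract_left scale \<epsilon> k (tens scale (us @ vs)) = tscale (\<Prod>v\<leftarrow>us. \<epsilon> v) (tens scale vs)"
proof -
  have "multilinear scale tscale (length (us @ vs))
      (\<lambda>xs. tscale (\<Prod>v\<leftarrow>take k xs. \<epsilon> v) (tens scale (drop k xs)))"
    unfolding multilinear_tensor_iff[OF V]
  proof
    fix f
    have "multilinear scale (*) (length vs) (\<lambda>xs. tens scale xs f)"
      using multilinear_tens[OF V] unfolding multilinear_tensor_iff[OF V] by blast
    from multilinear_split[OF V multilinear_character[OF V \<epsilon>] this, of k] us
    show "multilinear scale (*) (length (us @ vs))
        (\<lambda>xs. tscale (\<Prod>v\<leftarrow>take k xs. \<epsilon> v) (tens scale (drop k xs)) f)"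
      by (simp add: tscale_def)
  qed
  from tlift_tens[OF this] us show ?thesis by (simp add: contract_left_def)
qed

lemma contract_right_append:
  fixes scale :: "'k::field \<Rightarrow> 'v::ab_group_add \<Rightarrow> 'v"
  assumes V: "vector_space scale" and \<epsilon>: "Vector_Spaces.linear scale (*) \<epsilon>" and vs: "length vs = p"
  shows "contract_right scale \<epsilon> p (tens scale (vs @ ws)) = tscale (\<Prod>v\<leftarrow>ws. \<epsilon> v) (tens scale vs)"
proof -
  have "multilinear scale tscale (length (vs @ ws))
      (\<lambda>xs. tscale (\<Prod>v\<leftarrow>drop p xs. \<epsilon> v) (tens scale (take p xs)))"
    unfolding multilinear_tensor_iff[OF V]
  proof
    fix f
    have "multilinear scale (*) p (\<lambda>xs. tens scale xs f)"
      using multilinear_tens[OF V] unfolding multilinear_tensor_iff[OF V] by blast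
    from multilinear_split[OF V this multilinear_character[OF V \<epsilon>], of "length ws"] vs
    show "multilinear scale (*) (length (vs @ ws))
        (\<lambda>xs. tscale (\<Prod>v\<leftarrow>drop p xs. \<epsilon> v) (tens scale (take p xs)) f)"
      by (simp add: tscale_def mult.commute)
  qed
  from tlift_tens[OF this] vs show ?thesis by (simp add: contract_right_def)
qed

section \<open>The braid relations on tensor powers\<close>

lemma split_list_at:
  assumes "length vs = n" "p \<le> n"
  obtains us ws where "vs = us @ ws" "length us = p" "length ws = n - p"
  using assms append_take_drop_id[of p vs] by (metis length_drop length_take min.absorb2)

lemma split_list_block:
  assumes "length vs = n" "1 \<le> i" "i + l \<le> Suc n"
  obtains us xs ws where "vs = us @ xs @ ws" "Suc (length us) = i" "length xs = l"
    "length ws = Suc n - (i + l)"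
proof -
  have le: "i - 1 \<le> n" "l \<le> n - (i - 1)" using assms by auto
  obtain us rest where 1: "vs = us @ rest" "length us = i - 1" "length rest = n - (i - 1)"
    by (rule split_list_at[OF assms(1) le(1)])
  obtain xs ws where "rest = xs @ ws" "length xs = l" "length ws = n - (i - 1) - l"
    by (rule split_list_at[OF 1(3) le(2)])
  with 1 assms show ?thesis by (intro that[of us xs ws]) auto
qed

text \<open>The operator \<open>\<beta>\<close> is later instantiated to \<open>-\<sigma>\<close>.\<close>
locale braided_vector_space =
  fixes scale :: "'k::field \<Rightarrow> 'v::ab_group_add \<Rightarrow> 'v"
    and \<beta> :: "('v, 'k) tensor \<Rightarrow> ('v, 'k) tensor"
  assumes V: "vector_space scale" and braided: "pre_braiding scale \<beta>"
begin

abbreviation "TP \<equiv> tensor_power scale"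
abbreviation "b \<equiv> at_pos scale 2 2 \<beta>"

lemma hom: "tensor_hom scale 2 2 \<beta>"
  using braided by (simp add: pre_braiding_def)

lemma at_pos_pure:
  assumes "length xs = 2" "Suc (length us) = i"
  shows "b i (tens scale (us @ xs @ ws)) = tsandwich scale 2 us (\<beta> (tens scale xs)) ws"
  using at_pos_tens[OF V hom assms(1)] assms(2) by blast

lemma image_pure: "length xs = 2 \<Longrightarrow> \<beta> (tens scale xs) \<in> TP 2"
  using hom tens_in_tensor_power[of xs 2 scale] by (simp add: tensor_hom_def)

lemma at_pos_closed:
  assumes "1 \<le> i" "i < n" "x \<in> TP n"
  shows "b i x \<in> TP n"
  using linear_at_pos _ assms(3)
proof (rule linear_into_tensor_power)
  fix vs :: "'v list" assume "length vs = n"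
  then obtain us xs ws where vs: "vs = us @ xs @ ws" "Suc (length us) = i" "length xs = 2"
    "length ws = Suc n - (i + 2)"
    using assms by (elim split_list_block[of vs n i 2]) auto
  have "length us + 2 + length ws = n" using vs assms by simp
  then show "b i (tens scale vs) \<in> TP n"
    using tsandwich_in_tensor_power[OF image_pure[OF vs(3)], of us ws] vs by (simp add: at_pos_pure)
qed

text \<open>
  Locality: an operator acting inside the middle block does not see the outer factors.  It reduces
  the braid relation on all tensor powers to the third one.
\<close>
lemma at_pos_tsandwich:
  assumes y: "y \<in> TP r" and i: "1 \<le> i" "i < r"
  shows "b (length us + i) (tsandwich scale r us y ws) = tsandwich scale r us (b i y) ws"
  using linear_comp[OF linear_tsandwich linear_at_pos] linear_comp[OF linear_at_pos linear_tsandwich] _ y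
proof (rule tensor_power_linear_eq)
  fix vs :: "'v list" assume vs: "length vs = r"
  then obtain us' xs ws' where vs': "vs = us' @ xs @ ws'" "Suc (length us') = i" "length xs = 2"
    "length ws' = Suc r - (i + 2)"
    using i by (elim split_list_block[of vs r i 2]) auto
  have "b (length us + i) (tsandwich scale r us (tens scale vs) ws) =
      b (length us + i) (tens scale ((us @ us') @ xs @ ws' @ ws))"
    using tsandwich_tens[of scale vs us ws] vs vs'(1) by simp
  also have "\<dots> = tsandwich scale 2 (us @ us') (\<beta> (tens scale xs)) (ws' @ ws)"
    by (rule at_pos_pure) (use vs' in auto)
  also have "\<dots> = tsandwich scale r us (tsandwich scale 2 us' (\<beta> (tens scale xs)) ws') ws"
    by (rule tsandwich_nest[symmetric]) (use vs vs' in auto)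
  finally show "b (length us + i) (tsandwich scale r us (tens scale vs) ws) =
      tsandwich scale r us (b i (tens scale vs)) ws"
    using vs' by (simp add: at_pos_pure)
qed

text \<open>
  On a pure tensor the two operators insert the tensors \<open>X\<close> and \<open>Z\<close> in disjoint places; applying
  them in either order evaluates a form at \<open>X\<close> and at \<open>Z\<close>, and the two evaluations can be exchanged.
\<close>
lemma at_pos_commute:
  assumes ij: "1 \<le> i" "i + 2 \<le> j" "j < n" and x: "x \<in> TP n"
  shows "b i (b j x) = b j (b i x)"
  using linear_comp[OF linear_at_pos linear_at_pos] linear_comp[OF linear_at_pos linear_at_pos] _ x
proof (rule tensor_power_linear_eq)
  fix vs :: "'v list" assume "length vs = n"
  then obtain us xs rest where 1: "vs = us @ xs @ rest" "Suc (length us) = i" "length xs = 2"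
    "length rest = Suc n - (i + 2)"
    using ij by (elim split_list_block[of vs n i 2]) auto
  obtain ms zs ws where 2: "rest = ms @ zs @ ws" "Suc (length ms) = j - (i + 1)" "length zs = 2"
    "length ws = n - Suc j"
    using 1(4) ij by (elim split_list_block[of rest "Suc n - (i + 2)" "j - (i + 1)" 2]) auto
  define X where "X = \<beta> (tens scale xs)"
  define Z where "Z = \<beta> (tens scale zs)"
  have XZ: "X \<in> TP 2" "Z \<in> TP 2" using image_pure 1 2 by (simp_all add: X_def Z_def)
  have j: "Suc (length (us @ ts @ ms)) = j" if "length ts = 2" for ts :: "'v list"
    using that 1 2 ij by auto
  have bi: "b i (tens scale (us @ xs @ ms @ ts @ ws)) = tsandwich scale 2 us X (ms @ ts @ ws)"
    for ts :: "'v list"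
    using at_pos_pure[OF 1(3,2), of "ms @ ts @ ws"] by (simp add: X_def)
  have bj: "b j (tens scale (us @ ts @ ms @ zs @ ws)) = tsandwich scale 2 (us @ ts @ ms) Z ws"
    if "length ts = 2" for ts :: "'v list"
    using at_pos_pure[OF 2(3) j[OF that], of ws] by (simp add: Z_def)
  show "b i (b j (tens scale vs)) = b j (b i (tens scale vs))"
  proof
    fix f
    let ?ml = "multilinear scale (*) (length us + (length ms + (length ws + Suc (Suc (Suc (Suc 0)))))) f"
    have L: "b i (b j (tens scale vs)) f =
        Z (\<lambda>ts. if ?ml then X (\<lambda>ss. f (us @ ss @ ms @ ts @ ws)) else 0)"
    proof -
      have "b i (b j (tens scale vs)) f = b i (tsandwich scale 2 (us @ xs @ ms) Z ws) f"
        using bj[OF 1(3)] 1(1) 2(1) by simp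
      also have "\<dots> = Z (\<lambda>ts. b i (tens scale ((us @ xs @ ms) @ ts @ ws)) f)"
        by (rule linear_map_tsandwich[OF V linear_at_pos XZ(2)])
      also have "\<dots> = Z (\<lambda>ts. if ?ml then X (\<lambda>ss. f (us @ ss @ ms @ ts @ ws)) else 0)"
        using XZ(2) by (rule tensor_cong) (simp add: bi tsandwich_def add_ac)
      finally show ?thesis .
    qed
    have R: "b j (b i (tens scale vs)) f =
        X (\<lambda>ss. if ?ml then Z (\<lambda>ts. f (us @ ss @ ms @ ts @ ws)) else 0)"
    proof -
      have "b j (b i (tens scale vs)) f = b j (tsandwich scale 2 us X (ms @ zs @ ws)) f"
        using bi[of zs] 1(1) 2(1) by simp
      also have "\<dots> = X (\<lambda>ss. b j (tens scale (us @ ss @ ms @ zs @ ws)) f)"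
        by (rule linear_map_tsandwich[OF V linear_at_pos XZ(1)])
      also have "\<dots> = X (\<lambda>ss. if ?ml then Z (\<lambda>ts. f (us @ ss @ ms @ ts @ ws)) else 0)"
        using XZ(1) by (rule tensor_cong) (simp add: bj tsandwich_def add_ac)
      finally show ?thesis .
    qed
    show "b i (b j (tens scale vs)) f = b j (b i (tens scale vs)) f"
    proof (cases ?ml)
      case True
      have "Z (\<lambda>ts. X (\<lambda>ss. f (us @ ss @ ms @ ts @ ws))) = X (\<lambda>ss. Z (\<lambda>ts. f (us @ ss @ ms @ ts @ ws)))"
      proof (rule tensor_fubini[OF V XZ(2,1)])
        fix ts :: "'v list" assume "length ts = 2"
        then show "multilinear scale (*) 2 (\<lambda>ss. f (us @ ss @ ms @ ts @ ws))"
          using multilinear_middle[of scale us 2 "ms @ ts @ ws" f] True by (simp add: add_ac)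
      next
        fix ss :: "'v list" assume "length ss = 2"
        then show "multilinear scale (*) 2 (\<lambda>ts. f (us @ ss @ ms @ ts @ ws))"
          using multilinear_middle[of scale "us @ ss @ ms" 2 ws f] True by (simp add: add_ac)
      qed
      then show ?thesis using True by (simp add: L R)
    next
      case False
      then show ?thesis using tensor_zero_form[OF XZ(1)] tensor_zero_form[OF XZ(2)] by (simp add: L R)
    qed
  qed
qed

lemma at_pos_braid:
  assumes i: "1 \<le> i" "Suc i < n" and x: "x \<in> TP n"
  shows "b i (b (Suc i) (b i x)) = b (Suc i) (b i (b (Suc i) x))"
  using linear_comp[OF linear_comp[OF linear_at_pos linear_at_pos] linear_at_pos]
    linear_comp[OF linear_comp[OF linear_at_pos linear_at_pos] linear_at_pos] _ x
proof (rule tensor_power_linear_eq)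
  fix vs :: "'v list" assume "length vs = n"
  then obtain us xs ws where vs: "vs = us @ xs @ ws" "Suc (length us) = i" "length xs = 3"
    "length ws = Suc n - (i + 3)"
    using i by (elim split_list_block[of vs n i 3]) auto
  have local1: "b i (tsandwich scale 3 us y ws) = tsandwich scale 3 us (b 1 y) ws"
    and local2: "b (Suc i) (tsandwich scale 3 us y ws) = tsandwich scale 3 us (b 2 y) ws"
    if "y \<in> TP 3" for y
    using at_pos_tsandwich[OF that, of 1 us ws] at_pos_tsandwich[OF that, of 2 us ws] vs(2) by auto
  have 3: "tens scale xs \<in> TP 3" using vs(3) by (rule tens_in_tensor_power)
  have cl: "b 1 y \<in> TP 3" "b 2 y \<in> TP 3" if "y \<in> TP 3" for y
    using at_pos_closed[of _ 3] that by simp_all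
  have "tens scale vs = tsandwich scale 3 us (tens scale xs) ws"
    using tsandwich_tens[of scale xs us ws] vs by simp
  moreover have "b 1 (b 2 (b 1 (tens scale xs))) = b 2 (b 1 (b 2 (tens scale xs)))"
    using braided 3 by (simp add: pre_braiding_def Let_def)
  ultimately show "b i (b (Suc i) (b i (tens scale vs))) = b (Suc i) (b i (b (Suc i) (tens scale vs)))"
    by (simp add: local1[simplified] local2[simplified] cl[simplified] 3)
qed

sublocale braid_operators "TP n" b n for n
  using at_pos_closed at_pos_commute at_pos_braid
  by unfold_locales (auto simp: tensor_power_closed linear_tensor_mapD(1)[OF linear_at_pos])

lemma csh_eq_coshuffle:
  assumes "x \<in> TP (p + q)"
  shows "csh scale \<beta> p q x = coshuffle b p q x"
proof -
  have "perm_action scale \<beta> (p + q) (inv s) x = subset_op b p (s ` {1..p}) x"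
    if s: "s \<in> shuffles_perm p q" for s
  proof -
    define w where "w = (SOME w. shortest_expression (p + q) (inv s) w)"
    have "shortest_expression (p + q) (inv s) w"
      unfolding w_def by (rule someI_ex[OF shortest_expression_shuffle(1)[OF s]])
    then have "lowering p (s ` {1..p}) w" by (rule shortest_expression_shuffle(2)[OF s])
    then have "subset_op b p (s ` {1..p}) x = word_op b w x"
      using shuffle_image[OF s] assms by (intro subset_op_eq) auto
    then show ?thesis by (simp add: perm_action_def word_op_def w_def)
  qed
  then have "csh scale \<beta> p q x = (\<Sum>s\<in>shuffles_perm p q. subset_op b p (s ` {1..p}) x)"
    by (simp add: csh_def)
  also have "\<dots> = (\<Sum>A | A \<subseteq> {1..p + q} \<and> card A = p. subset_op b p A x)"
    by (rule sum.reindex_bij_betw[OF bij_betw_shuffles_subsets])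
  also have "\<dots> = coshuffle b p q x"
    by (rule sum_subset_op[OF order_refl assms])
  finally show ?thesis .
qed

end

lemma pre_braiding_uminus:
  fixes scale :: "'k::field \<Rightarrow> 'v::ab_group_add \<Rightarrow> 'v"
  assumes V: "vector_space scale" and \<sigma>: "pre_braiding scale \<sigma>"
  shows "pre_braiding scale (\<lambda>y. - \<sigma> y)"
proof -
  interpret s: braided_vector_space scale \<sigma> using assms by (rule braided_vector_space.intro)
  have hom: "tensor_hom scale 2 2 (\<lambda>y. - \<sigma> y)"
    using s.hom by (auto simp: tensor_hom_def uminus_tensor tensor_power_closed)
      (auto simp: tscale_def fun_eq_iff algebra_simps)
  have neg: "at_pos scale 2 2 (\<lambda>y. - \<sigma> y) i x = tscale (- 1) (at_pos scale 2 2 \<sigma> i x)"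
    if i: "1 \<le> i" "i < 3" and x: "x \<in> tensor_power scale 3" for i x
    using linear_at_pos linear_tscale_map[OF linear_at_pos] _ x
  proof (rule tensor_power_linear_eq)
    fix vs :: "'v list" assume "length vs = 3"
    then obtain us xs ws where vs: "vs = us @ xs @ ws" "Suc (length us) = i" "length xs = 2"
      using i by (elim split_list_block[of vs 3 i 2]) auto
    show "at_pos scale 2 2 (\<lambda>y. - \<sigma> y) i (tens scale vs) = tscale (- 1) (at_pos scale 2 2 \<sigma> i (tens scale vs))"
      using at_pos_tens[OF V hom vs(3), of us ws] at_pos_tens[OF V s.hom vs(3), of us ws] vs(1,2)
      by (auto simp: tsandwich_def tscale_def fun_eq_iff)
  qed
  have "at_pos scale 2 2 \<sigma> i x \<in> tensor_power scale 3" if "i = 1 \<or> i = 2" "x \<in> tensor_power scale 3" for i x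
    using s.at_pos_closed[of i 3 x] that by auto
  moreover have "at_pos scale 2 2 \<sigma> 1 (at_pos scale 2 2 \<sigma> 2 (at_pos scale 2 2 \<sigma> 1 x)) =
      at_pos scale 2 2 \<sigma> 2 (at_pos scale 2 2 \<sigma> 1 (at_pos scale 2 2 \<sigma> 2 x))" if "x \<in> tensor_power scale 3" for x
    using \<sigma> that by (simp add: pre_braiding_def Let_def)
  ultimately show ?thesis
    using hom by (simp add: pre_braiding_def Let_def neg linear_tensor_mapD(2)[OF linear_at_pos] tensor_power_closed)
qed

section \<open>Contraction with a braided character\<close>

text \<open>For \<open>\<beta> = -\<sigma>\<close>, invariance of \<open>\<epsilon> \<otimes> \<epsilon>\<close> under \<open>\<sigma>\<close> becomes a sign.\<close>
locale sign_braided_character = braided_vector_space scale \<beta>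
  for scale :: "'k::field \<Rightarrow> 'v::ab_group_add \<Rightarrow> 'v"
    and \<beta> :: "('v, 'k) tensor \<Rightarrow> ('v, 'k) tensor" +
  fixes \<epsilon> :: "'v \<Rightarrow> 'k"
  assumes \<epsilon>: "Vector_Spaces.linear scale (*) \<epsilon>"
    and skew: "x \<in> tensor_power scale 2 \<Longrightarrow> \<beta> x (\<lambda>vs. \<Prod>v\<leftarrow>vs. \<epsilon> v) = - x (\<lambda>vs. \<Prod>v\<leftarrow>vs. \<epsilon> v)"
begin

abbreviation "\<epsilon>s \<equiv> (\<lambda>vs. \<Prod>v\<leftarrow>vs. \<epsilon> v)"

lemmas left_append = contract_left_append[OF V \<epsilon>]
lemmas right_append = contract_right_append[OF V \<epsilon>]

lemma character_tens: "tens scale vs \<epsilon>s = \<epsilon>s vs"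
  using multilinear_character[OF V \<epsilon>] by (simp add: tens_def)

lemma character_tsandwich:
  assumes "y \<in> TP r"
  shows "tsandwich scale r us y ws \<epsilon>s = (\<epsilon>s us * \<epsilon>s ws) * y \<epsilon>s"
  using assms
proof (induction rule: tensor_power_induct)
  case (tens vs)
  then show ?case using tsandwich_tens[of scale vs us ws] by (simp add: character_tens)
next
  case (add x y)
  then show ?case unfolding linear_tensor_mapD(1)[OF linear_tsandwich] by (simp add: distrib_left)
qed (simp_all add: linear_tensor_mapD(2)[OF linear_tsandwich], simp_all add: tsandwich_def tscale_def)

lemma character_at_pos:
  assumes i: "1 \<le> i" "i < n" and x: "x \<in> TP n"
  shows "b i x \<epsilon>s = - x \<epsilon>s"
  using x
proof (induction rule: tensor_power_induct)
  case (tens vs)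
  then obtain us xs ws where vs: "vs = us @ xs @ ws" "Suc (length us) = i" "length xs = 2"
    using i by (elim split_list_block[of vs n i 2]) auto
  then have "b i (tens scale vs) \<epsilon>s = \<epsilon>s us * \<epsilon>s ws * \<beta> (tens scale xs) \<epsilon>s"
    by (simp only: at_pos_pure character_tsandwich[OF image_pure[OF vs(3)]])
  also have "\<dots> = - tens scale vs \<epsilon>s"
    using skew[OF tens_in_tensor_power[OF vs(3)]] vs(1) by (simp add: character_tens)
  finally show ?case .
next
  case zero
  have "b i 0 = 0" using additive[of i 0 0] by simp
  then show ?case by (simp only:) simp
next
  case (add x y)
  then show ?case unfolding additive by simp
next
  case (scale c x)
  then show ?case unfolding linear_tensor_mapD(2)[OF linear_at_pos] by (simp add: tscale_def)
qed

lemma contract_left_tsandwich: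
  assumes "length us = k" "y \<in> TP r"
  shows "contract_left scale \<epsilon> k (tsandwich scale r us y []) = tscale (\<epsilon>s us) y"
  using linear_comp[OF linear_tsandwich linear_contract_left] linear_tscale_map[OF linear_tensor_id] _ assms(2)
proof (rule tensor_power_linear_eq)
  fix vs :: "'v list" assume "length vs = r"
  then show "contract_left scale \<epsilon> k (tsandwich scale r us (tens scale vs) []) = tscale (\<epsilon>s us) (tens scale vs)"
    using tsandwich_tens[of scale vs us "[]"] assms(1) by (simp add: left_append)
qed

lemma contract_right_tsandwich:
  assumes "y \<in> TP p"
  shows "contract_right scale \<epsilon> p (tsandwich scale p [] y ws) = tscale (\<epsilon>s ws) y"
  using linear_comp[OF linear_tsandwich linear_contract_right] linear_tscale_map[OF linear_tensor_id] _ assms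
proof (rule tensor_power_linear_eq)
  fix vs :: "'v list" assume "length vs = p"
  then show "contract_right scale \<epsilon> p (tsandwich scale p [] (tens scale vs) ws) = tscale (\<epsilon>s ws) (tens scale vs)"
    using tsandwich_tens[of scale vs "[]" ws] by (simp add: right_append)
qed

lemma contract_left_tsandwich_character:
  assumes "y \<in> TP k"
  shows "contract_left scale \<epsilon> k (tsandwich scale k [] y ws) = tscale (y \<epsilon>s) (tens scale ws)"
  using assms
proof (induction rule: tensor_power_induct)
  case (tens vs)
  then show ?case
    using tsandwich_tens[of scale vs "[]" ws] by (simp add: left_append character_tens)
next
  case zero
  show ?case by (simp add: tsandwich_def contract_left_def tlift_def tscale_def)
qed (simp_all only: linear_tensor_mapD[OF linear_tsandwich] linear_tensor_mapD[OF linear_contract_left],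
  simp_all add: tscale_def fun_eq_iff algebra_simps)

lemma contract_right_tsandwich_character:
  assumes "length us = p" "y \<in> TP r"
  shows "contract_right scale \<epsilon> p (tsandwich scale r us y []) = tscale (y \<epsilon>s) (tens scale us)"
  using assms(2)
proof (induction rule: tensor_power_induct)
  case (tens vs)
  then show ?case
    using tsandwich_tens[of scale vs us "[]"] assms(1) by (simp add: right_append character_tens)
next
  case zero
  show ?case by (simp add: tsandwich_def contract_right_def tlift_def tscale_def)
qed (simp_all only: linear_tensor_mapD[OF linear_tsandwich] linear_tensor_mapD[OF linear_contract_right],
  simp_all add: tscale_def fun_eq_iff algebra_simps)

lemma contract_left_closed:
  assumes "x \<in> TP (k + n)"
  shows "contract_left scale \<epsilon> k x \<in> TP n"
  using linear_contract_left _ assms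
proof (rule linear_into_tensor_power)
  fix vs :: "'v list" assume "length vs = k + n"
  then obtain us ws where "vs = us @ ws" "length us = k" "length ws = n"
    by (elim split_list_at[of vs "k + n" k]) auto
  then show "contract_left scale \<epsilon> k (tens scale vs) \<in> TP n"
    by (simp add: left_append tens_in_tensor_power tensor_power_closed)
qed

lemma contract_right_closed:
  assumes "x \<in> TP (p + q)"
  shows "contract_right scale \<epsilon> p x \<in> TP p"
  using linear_contract_right _ assms
proof (rule linear_into_tensor_power)
  fix vs :: "'v list" assume "length vs = p + q"
  then obtain us ws where "vs = us @ ws" "length us = p" "length ws = q"
    by (elim split_list_at[of vs "p + q" p]) auto
  then show "contract_right scale \<epsilon> p (tens scale vs) \<in> TP p"
    by (simp add: right_append tens_in_tensor_power tensor_power_closed)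
qed

lemma contract_left_shift:
  assumes i: "1 \<le> i" "i < n" and x: "x \<in> TP (k + n)"
  shows "contract_left scale \<epsilon> k (b (k + i) x) = b i (contract_left scale \<epsilon> k x)"
  using linear_comp[OF linear_at_pos linear_contract_left] linear_comp[OF linear_contract_left linear_at_pos] _ x
proof (rule tensor_power_linear_eq)
  fix vs :: "'v list" assume "length vs = k + n"
  then obtain us ws where vs: "vs = us @ ws" "length us = k" "length ws = n"
    by (elim split_list_at[of vs "k + n" k]) auto
  have ws: "tens scale ws \<in> TP n" using vs(3) by (rule tens_in_tensor_power)
  have "b (k + i) (tens scale vs) = tsandwich scale n us (b i (tens scale ws)) []"
    using at_pos_tsandwich[OF ws i, of us "[]"] tsandwich_tens[of scale ws us "[]"] vs by simp
  then show "contract_left scale \<epsilon> k (b (k + i) (tens scale vs)) = b i (contract_left scale \<epsilon> k (tens scale vs))"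
    using contract_left_tsandwich[OF vs(2) at_pos_closed[OF i ws]] vs
    by (simp add: left_append linear_tensor_mapD(2)[OF linear_at_pos])
qed

lemma contract_right_commute:
  assumes i: "1 \<le> i" "i < p" and x: "x \<in> TP (p + q)"
  shows "contract_right scale \<epsilon> p (b i x) = b i (contract_right scale \<epsilon> p x)"
  using linear_comp[OF linear_at_pos linear_contract_right] linear_comp[OF linear_contract_right linear_at_pos] _ x
proof (rule tensor_power_linear_eq)
  fix vs :: "'v list" assume "length vs = p + q"
  then obtain us ws where vs: "vs = us @ ws" "length us = p" "length ws = q"
    by (elim split_list_at[of vs "p + q" p]) auto
  have us: "tens scale us \<in> TP p" using vs(2) by (rule tens_in_tensor_power)
  have "b i (tens scale vs) = tsandwich scale p [] (b i (tens scale us)) ws"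
    using at_pos_tsandwich[OF us i, of "[]" ws] tsandwich_tens[of scale us "[]" ws] vs by simp
  then show "contract_right scale \<epsilon> p (b i (tens scale vs)) = b i (contract_right scale \<epsilon> p (tens scale vs))"
    using contract_right_tsandwich[OF at_pos_closed[OF i us]] vs
    by (simp add: right_append linear_tensor_mapD(2)[OF linear_at_pos])
qed

lemma contract_left_skew:
  assumes i: "1 \<le> i" "i < k" and x: "x \<in> TP (k + n)"
  shows "contract_left scale \<epsilon> k (b i x) = - contract_left scale \<epsilon> k x"
  unfolding uminus_tensor
  using linear_comp[OF linear_at_pos linear_contract_left] linear_tscale_map[OF linear_contract_left] _ x
proof (rule tensor_power_linear_eq)
  fix vs :: "'v list" assume "length vs = k + n"
  then obtain us ws where vs: "vs = us @ ws" "length us = k" "length ws = n"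
    by (elim split_list_at[of vs "k + n" k]) auto
  have us: "tens scale us \<in> TP k" using vs(2) by (rule tens_in_tensor_power)
  have "b i (tens scale vs) = tsandwich scale k [] (b i (tens scale us)) ws"
    using at_pos_tsandwich[OF us i, of "[]" ws] tsandwich_tens[of scale us "[]" ws] vs by simp
  then show "contract_left scale \<epsilon> k (b i (tens scale vs)) = tscale (- 1) (contract_left scale \<epsilon> k (tens scale vs))"
    using contract_left_tsandwich_character[OF at_pos_closed[OF i us]] character_at_pos[OF i us] vs
    by (simp add: left_append character_tens)
qed

lemma contract_right_skew:
  assumes i: "1 \<le> i" "i < q" and x: "x \<in> TP (p + q)"
  shows "contract_right scale \<epsilon> p (b (p + i) x) = - contract_right scale \<epsilon> p x"
  unfolding uminus_tensor
  using linear_comp[OF linear_at_pos linear_contract_right] linear_tscale_map[OF linear_contract_right] _ x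
proof (rule tensor_power_linear_eq)
  fix vs :: "'v list" assume "length vs = p + q"
  then obtain us ws where vs: "vs = us @ ws" "length us = p" "length ws = q"
    by (elim split_list_at[of vs "p + q" p]) auto
  have ws: "tens scale ws \<in> TP q" using vs(3) by (rule tens_in_tensor_power)
  have "b (p + i) (tens scale vs) = tsandwich scale q us (b i (tens scale ws)) []"
    using at_pos_tsandwich[OF ws i, of us "[]"] tsandwich_tens[of scale ws us "[]"] vs by simp
  then show "contract_right scale \<epsilon> p (b (p + i) (tens scale vs)) = tscale (- 1) (contract_right scale \<epsilon> p (tens scale vs))"
    using contract_right_tsandwich_character[OF vs(2) at_pos_closed[OF i ws]] character_at_pos[OF i ws] vs
    by (simp add: right_append character_tens)
qed

lemma contract_left_comp:
  assumes "x \<in> TP (k + m + n)"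
  shows "contract_left scale \<epsilon> m (contract_left scale \<epsilon> k x) = contract_left scale \<epsilon> (k + m) x"
  using linear_comp[OF linear_contract_left linear_contract_left] linear_contract_left _ assms
proof (rule tensor_power_linear_eq)
  fix vs :: "'v list" assume "length vs = k + m + n"
  then obtain us rest where 1: "vs = us @ rest" "length us = k" "length rest = m + n"
    by (elim split_list_at[of vs "k + m + n" k]) auto
  then obtain ms ws where 2: "rest = ms @ ws" "length ms = m"
    by (elim split_list_at[of rest "m + n" m]) auto
  show "contract_left scale \<epsilon> m (contract_left scale \<epsilon> k (tens scale vs)) = contract_left scale \<epsilon> (k + m) (tens scale vs)"
    using left_append[OF 1(2), of rest] left_append[OF 2(2), of ws] left_append[of "us @ ms" "k + m" ws] 1 2
    by (simp add: linear_tensor_mapD(2)[OF linear_contract_left])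
qed

lemma contract_right_comp:
  assumes "x \<in> TP (p + m + k)"
  shows "contract_right scale \<epsilon> p (contract_right scale \<epsilon> (p + m) x) = contract_right scale \<epsilon> p x"
  using linear_comp[OF linear_contract_right linear_contract_right] linear_contract_right _ assms
proof (rule tensor_power_linear_eq)
  fix vs :: "'v list" assume "length vs = p + m + k"
  then obtain us rest where 1: "vs = us @ rest" "length us = p" "length rest = m + k"
    by (elim split_list_at[of vs "p + m + k" p]) auto
  then obtain ms ws where 2: "rest = ms @ ws" "length ms = m"
    by (elim split_list_at[of rest "m + k" m]) auto
  show "contract_right scale \<epsilon> p (contract_right scale \<epsilon> (p + m) (tens scale vs)) = contract_right scale \<epsilon> p (tens scale vs)"
    using right_append[OF 1(2), of ms] right_append[of "us @ ms" "p + m" ws] right_append[OF 1(2), of rest] 1 2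
    by (simp add: linear_tensor_mapD(2)[OF linear_contract_right] mult.commute)
qed

text \<open>
  All shuffled factors are contracted, so each operator contributes a sign and the signed count of
  the shuffles remains.
\<close>
lemma contract_left_coshuffle:
  assumes "x \<in> TP (k + m + n)"
  shows "contract_left scale \<epsilon> (k + m) (coshuffle b k m x) =
    tscale (of_nat (binomial_minus_one k m)) (contract_left scale \<epsilon> (k + m) x)"
proof -
  have "contract_left scale \<epsilon> (k + m) (coshuffle b k m x) =
      coshuffle (\<lambda>i y. - y) k m (contract_left scale \<epsilon> (k + m) x)"
    using coshuffle_intertwine[of "TP (k + m + n)" "contract_left scale \<epsilon> (k + m)" k m b "\<lambda>i y. - y" x]
      contract_left_skew at_pos_closed assms
    by (simp add: tensor_power_closed linear_tensor_mapD(1)[OF linear_contract_left])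
  then show ?thesis by (simp add: coshuffle_uminus)
qed

lemma contract_right_coshuffle:
  assumes "x \<in> TP (p + (m + k))"
  shows "contract_right scale \<epsilon> p (coshuffle (\<lambda>i. b (p + i)) m k x) =
    tscale (of_nat (binomial_minus_one m k)) (contract_right scale \<epsilon> p x)"
proof -
  have "contract_right scale \<epsilon> p (coshuffle (\<lambda>i. b (p + i)) m k x) =
      coshuffle (\<lambda>i y. - y) m k (contract_right scale \<epsilon> p x)"
    using coshuffle_intertwine[of "TP (p + (m + k))" "contract_right scale \<epsilon> p" m k
        "\<lambda>i. b (p + i)" "\<lambda>i y. - y" x]
      contract_right_skew[of _ "m + k" _ p] at_pos_closed assms
    by (simp add: tensor_power_closed linear_tensor_mapD(1)[OF linear_contract_right])
  then show ?thesis by (simp add: coshuffle_uminus)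
qed

lemma coshuffle_closed:
  assumes "p + q \<le> n" "x \<in> TP n"
  shows "coshuffle b p q x \<in> TP n"
  using coshuffle_intertwine[of "TP n" id p q b b x] assms at_pos_closed
  by (simp add: tensor_power_closed)

lemma coshuffle_scale: "coshuffle b p q (tscale c x) = tscale c (coshuffle b p q x)"
proof -
  have "tscale c (y + z) = tscale c y + tscale c z" for y z :: "('v, 'k) tensor"
    by (simp add: tscale_def fun_eq_iff algebra_simps)
  then show ?thesis
    using coshuffle_intertwine[of UNIV "tscale c" p q b b x]
    by (simp add: linear_tensor_mapD(2)[OF linear_at_pos])
qed

section \<open>Composition of hyper-boundaries\<close>

text \<open>
  Moving the inner contraction to the left of the outer coshuffle shifts the latter by \<open>k\<close>
  positions, the form in which it occurs in coassociativity.
\<close>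
theorem left_contraction_composition:
  assumes x: "x \<in> TP (k + m + j)"
  shows "contract_left scale \<epsilon> m (csh scale \<beta> m j (contract_left scale \<epsilon> k (csh scale \<beta> k (m + j) x))) =
    tscale (of_nat (binomial_minus_one m k)) (contract_left scale \<epsilon> (k + m) (csh scale \<beta> (k + m) j x))"
proof -
  define y where "y = coshuffle b k (m + j) x"
  have y: "y \<in> TP (k + (m + j))" unfolding y_def by (rule coshuffle_closed) (use x in \<open>simp_all add: add.assoc\<close>)
  define z where "z = coshuffle b (k + m) j x"
  have z: "z \<in> TP (k + m + j)" unfolding z_def by (rule coshuffle_closed) (use x in simp_all)
  have csh: "csh scale \<beta> k (m + j) x = y" "csh scale \<beta> (k + m) j x = z"
    "csh scale \<beta> m j (contract_left scale \<epsilon> k y) = coshuffle b m j (contract_left scale \<epsilon> k y)"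
    using x contract_left_closed[OF y] by (simp_all add: csh_eq_coshuffle y_def z_def add.assoc)
  have e1: "coshuffle b m j (contract_left scale \<epsilon> k y) =
      contract_left scale \<epsilon> k (coshuffle (\<lambda>i. b (k + i)) m j y)"
    using coshuffle_intertwine[of "TP (k + (m + j))" "contract_left scale \<epsilon> k" m j "\<lambda>i. b (k + i)" b y]
      contract_left_shift[of _ "m + j"] at_pos_closed y
    by (simp add: tensor_power_closed linear_tensor_mapD(1)[OF linear_contract_left])
  have e2: "coshuffle (\<lambda>i. b (k + i)) m j y = coshuffle b k m z"
    unfolding y_def z_def by (rule coshuffle_coassoc[OF order_refl x])
  have e3: "contract_left scale \<epsilon> m (contract_left scale \<epsilon> k (coshuffle b k m z)) =
      contract_left scale \<epsilon> (k + m) (coshuffle b k m z)"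
    by (rule contract_left_comp[OF coshuffle_closed[OF _ z]]) simp
  have e4: "contract_left scale \<epsilon> (k + m) (coshuffle b k m z) =
      tscale (of_nat (binomial_minus_one m k)) (contract_left scale \<epsilon> (k + m) z)"
    unfolding binomial_minus_one_commute[of m k] by (rule contract_left_coshuffle[OF z])
  show ?thesis by (simp only: csh e1 e2 e3 e4)
qed

text \<open>
  Here the inner contraction removes the last factors, so the outer coshuffle passes through it
  without a shift of positions, and coassociativity produces the coshuffle on the contracted end.
\<close>
theorem right_contraction_composition:
  assumes x: "x \<in> TP (j + m + k)"
  shows "contract_right scale \<epsilon> j (csh scale \<beta> j m (contract_right scale \<epsilon> (j + m) (csh scale \<beta> (j + m) k x))) =
    tscale (of_nat (binomial_minus_one m k)) (contract_right scale \<epsilon> j (csh scale \<beta> j (m + k) x))"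
proof -
  define y where "y = coshuffle b (j + m) k x"
  have y: "y \<in> TP (j + m + k)" unfolding y_def by (rule coshuffle_closed) (use x in simp_all)
  define z where "z = coshuffle b j (m + k) x"
  have z: "z \<in> TP (j + (m + k))" unfolding z_def by (rule coshuffle_closed) (use x in \<open>simp_all add: add.assoc\<close>)
  have csh: "csh scale \<beta> (j + m) k x = y" "csh scale \<beta> j (m + k) x = z"
    "csh scale \<beta> j m (contract_right scale \<epsilon> (j + m) y) = coshuffle b j m (contract_right scale \<epsilon> (j + m) y)"
    using x contract_right_closed[OF y] by (simp_all add: csh_eq_coshuffle y_def z_def add.assoc)
  have e1: "coshuffle b j m (contract_right scale \<epsilon> (j + m) y) =
      contract_right scale \<epsilon> (j + m) (coshuffle b j m y)"
    using coshuffle_intertwine[of "TP (j + m + k)" "contract_right scale \<epsilon> (j + m)" j m b b y]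
      contract_right_commute[of _ "j + m"] at_pos_closed y
    by (simp add: tensor_power_closed linear_tensor_mapD(1)[OF linear_contract_right])
  have e2: "coshuffle b j m y = coshuffle (\<lambda>i. b (j + i)) m k z"
    unfolding y_def z_def by (rule coshuffle_coassoc[OF order_refl x, symmetric])
  have e3: "contract_right scale \<epsilon> j (contract_right scale \<epsilon> (j + m) (coshuffle (\<lambda>i. b (j + i)) m k z)) =
      contract_right scale \<epsilon> j (coshuffle (\<lambda>i. b (j + i)) m k z)"
  proof (rule contract_right_comp)
    show "coshuffle (\<lambda>i. b (j + i)) m k z \<in> TP (j + m + k)"
      using coshuffle_coassoc[OF order_refl x] coshuffle_closed[OF _ y, of j m] by (simp add: y_def z_def)
  qed
  have e4: "contract_right scale \<epsilon> j (coshuffle (\<lambda>i. b (j + i)) m k z) =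
      tscale (of_nat (binomial_minus_one m k)) (contract_right scale \<epsilon> j z)"
    by (rule contract_right_coshuffle[OF z])
  show ?thesis by (simp only: csh e1 e2 e3 e4)
qed

end

text \<open>
  With \<open>t\<^sub>i = i (i + 1) / 2\<close> one has \<open>t\<^bsub>m+k\<^esub> = t\<^sub>m + t\<^sub>k + m k\<close>, and the term \<open>m k\<close> compensates for the
  lower degree \<open>n - k\<close> at which the second boundary acts.
\<close>
lemma sign_exponent_add:
  fixes j m k :: nat
  defines "n \<equiv> j + m + k"
  shows "(m * (j + m) - m * (m + 1) div 2) + (k * n - k * (k + 1) div 2) =
    (m + k) * n - (m + k) * (m + k + 1) div 2"
proof -
  define t where "t i = i * (i + 1) div 2" for i :: nat
  have t: "2 * t i = i * (i + 1)" for i by (simp add: t_def)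
  have le: "t i \<le> i * l" if "i \<le> l" for i l
  proof -
    have "i * (i + 1) \<le> 2 * (i * i)" by (cases i) auto
    moreover have "i * i \<le> i * l" using that by simp
    ultimately show ?thesis using t[of i] by linarith
  qed
  have "t k \<le> k * n" "t m \<le> m * (j + m)" "t (m + k) \<le> (m + k) * n"
    by (rule le; simp add: n_def)+
  moreover have "(m + k) * (m + k + 1) = m * (m + 1) + k * (k + 1) + 2 * (m * k)"
    by (simp add: algebra_simps)
  then have "t (m + k) = t m + t k + m * k" using t[of m] t[of k] t[of "m + k"] by linarith
  moreover have "(m + k) * n = m * (j + m) + k * n + m * k" by (simp add: n_def algebra_simps)
  ultimately show ?thesis unfolding t_def[symmetric] by linarith
qed

theorem theorem4:
  fixes scale :: "'k::field \<Rightarrow> 'v::ab_group_add \<Rightarrow> 'v"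
    and \<sigma> :: "('v, 'k) tensor \<Rightarrow> ('v, 'k) tensor"
    and \<epsilon> :: "'v \<Rightarrow> 'k"
    and m k :: nat
  assumes "vector_space scale"
    and "pre_braiding scale \<sigma>"
    and "braided_character scale \<sigma> \<epsilon>"
  shows "(\<forall>x \<in> tensor_algebra scale.
            left_hyper_boundary scale \<sigma> \<epsilon> m (left_hyper_boundary scale \<sigma> \<epsilon> k x) =
            graded_scale (of_nat (binomial_minus_one m k))
              (left_hyper_boundary scale \<sigma> \<epsilon> (m + k) x)) \<and>
         (\<forall>x \<in> tensor_algebra scale.
            right_hyper_boundary scale \<sigma> \<epsilon> m (right_hyper_boundary scale \<sigma> \<epsilon> k x) =
            graded_scale (of_nat (binomial_minus_one m k))
              (right_hyper_boundary scale \<sigma> \<epsilon> (m + k) x))"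
proof -
  interpret sign_braided_character scale "\<lambda>y. - \<sigma> y" \<epsilon>
    using assms pre_braiding_uminus[OF assms(1,2)]
    by (auto simp: braided_character_def Let_def sign_braided_character_def sign_braided_character_axioms_def
        braided_vector_space_def)
  show ?thesis
  proof (intro conjI ballI ext)
    fix x :: "nat \<Rightarrow> ('v, 'k) tensor" and j f assume "x \<in> tensor_algebra scale"
    then have x: "x n \<in> tensor_power scale n" for n by (simp add: tensor_algebra_def)
    have "left_hyper_boundary scale \<sigma> \<epsilon> m (left_hyper_boundary scale \<sigma> \<epsilon> k x) j =
        graded_scale (of_nat (binomial_minus_one m k)) (left_hyper_boundary scale \<sigma> \<epsilon> (m + k) x) j"
      using left_contraction_composition[of "x (k + m + j)" k m j] x
      by (simp add: left_hyper_boundary_def left_hyper_boundary_on_def graded_scale_def add_ac)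
    then show "left_hyper_boundary scale \<sigma> \<epsilon> m (left_hyper_boundary scale \<sigma> \<epsilon> k x) j f =
        graded_scale (of_nat (binomial_minus_one m k)) (left_hyper_boundary scale \<sigma> \<epsilon> (m + k) x) j f"
      by simp
  next
    fix x :: "nat \<Rightarrow> ('v, 'k) tensor" and j f assume "x \<in> tensor_algebra scale"
    then have x: "x (j + m + k) \<in> tensor_power scale (j + m + k)" by (simp add: tensor_algebra_def)
    let ?\<beta> = "\<lambda>y. - \<sigma> y"
    define y where "y = contract_right scale \<epsilon> (j + m) (csh scale ?\<beta> (j + m) k (x (j + m + k)))"
    have y: "y \<in> tensor_power scale (j + m)"
      unfolding y_def csh_eq_coshuffle[OF x]
      by (rule contract_right_closed[OF coshuffle_closed[OF _ x]]) simp
    have inner: "csh scale ?\<beta> j m (tscale c y) = tscale c (csh scale ?\<beta> j m y)" for c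
      using y by (simp add: csh_eq_coshuffle tensor_power_closed coshuffle_scale)
    have "right_hyper_boundary scale \<sigma> \<epsilon> m (right_hyper_boundary scale \<sigma> \<epsilon> k x) j =
        tscale ((- 1) ^ (m * (j + m) - m * (m + 1) div 2) * (- 1) ^ (k * (j + m + k) - k * (k + 1) div 2))
          (contract_right scale \<epsilon> j (csh scale ?\<beta> j m y))"
      by (simp add: right_hyper_boundary_def right_hyper_boundary_on_def y_def[symmetric] inner
          linear_tensor_mapD(2)[OF linear_contract_right])
    also have "(- 1 :: 'k) ^ (m * (j + m) - m * (m + 1) div 2) * (- 1) ^ (k * (j + m + k) - k * (k + 1) div 2) =
        (- 1) ^ ((m + k) * (j + m + k) - (m + k) * (m + k + 1) div 2)"
      unfolding power_add[symmetric] sign_exponent_add ..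
    also have "contract_right scale \<epsilon> j (csh scale ?\<beta> j m y) =
        tscale (of_nat (binomial_minus_one m k))
          (contract_right scale \<epsilon> j (csh scale ?\<beta> j (m + k) (x (j + m + k))))"
      unfolding y_def by (rule right_contraction_composition[OF x])
    finally have "right_hyper_boundary scale \<sigma> \<epsilon> m (right_hyper_boundary scale \<sigma> \<epsilon> k x) j =
        graded_scale (of_nat (binomial_minus_one m k)) (right_hyper_boundary scale \<sigma> \<epsilon> (m + k) x) j"
      by (simp add: right_hyper_boundary_def right_hyper_boundary_on_def graded_scale_def add.assoc mult.commute)
    then show "right_hyper_boundary scale \<sigma> \<epsilon> m (right_hyper_boundary scale \<sigma> \<epsilon> k x) j f =
        graded_scale (of_nat (binomial_minus_one m k)) (right_hyper_boundary scale \<sigma> \<epsilon> (m + k) x) j f"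
      by simp
  qed
qed

end
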